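(* Let $m,n\ge 2$ and $1\le k\le m$ be integers, let $\alpha\in\mathbb{R}$ and $B\in M_{m,n}$, and let $\Phi^{+}_{\alpha,B}:M_n\to M_m$ be $\Phi^{+}_{\alpha,B}(X)=\alpha\,\mathrm{tr}(X)I_m+BXB^*$. If $k=1$ or $\mathrm{rank}(B)\le 1$, then $\Phi^{+}_{\alpha,B}$ is $k$-copositive if and only if $\alpha\ge 0$. Otherwise, $\Phi^{+}_{\alpha,B}$ is $k$-copositive if and only if $\alpha\ge\sigma_1(B)\sigma_2(B)$.
   Context: $M_{m,n}$ is the set of $m\times n$ complex matrices, $M_n=M_{n,n}$. Singular values of $B$ are $\sigma_1(B)\ge\sigma_2(B)\ge\cdots\ge\sigma_{\min\{m,n\}}(B)\ge 0$. A linear map $\Phi:M_n\to M_m$ is $k$-positive if for every positive semidefinite block matrix $[A_{ij}]_{i,j=1}^k$ with $A_{ij}\in M_n$, the block matrix $[\Phi(A_{ij})]_{i,j=1}^k$ is positive semidefinite. $\Phi$ is $k$-copositive if $\Phi\circ\mathbf{T}$ is $k$-positive, where $\mathbf{T}(A)=A^\top$ is the transpose map on $M_n$. *)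

theory Defs
  imports
    "Jordan_Normal_Form.Spectral_Radius"
    "Jordan_Normal_Form.DL_Rank"
    "HOL-Library.Multiset"
begin

definition mat_trace :: "complex mat \<Rightarrow> complex" where
  "mat_trace A = (\<Sum>i<dim_row A. A $$ (i, i))"

(* The order on complex is the one of HOL-Library.Complex_Order: 0 \<le> z says that z is real and
   nonnegative.  (A *\<^sub>v v) \<bullet>c v is v^* A v. *)
definition pos_semidef :: "complex mat \<Rightarrow> bool" where
  "pos_semidef A \<longleftrightarrow> square_mat A \<and> mat_adjoint A = A \<and>
     (\<forall>v \<in> carrier_vec (dim_row A). 0 \<le> (A *\<^sub>v v) \<bullet>c v)"

(* The k x k block matrix [A i j] with blocks of size d x d; all indices start at 0. *)
definition block_matrix :: "nat \<Rightarrow> nat \<Rightarrow> (nat \<Rightarrow> nat \<Rightarrow> complex mat) \<Rightarrow> complex mat" where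
  "block_matrix k d A =
     mat (k * d) (k * d) (\<lambda>(r, c). A (r div d) (c div d) $$ (r mod d, c mod d))"

definition linear_mat_map :: "nat \<Rightarrow> nat \<Rightarrow> (complex mat \<Rightarrow> complex mat) \<Rightarrow> bool" where
  "linear_mat_map n m \<Phi> \<longleftrightarrow>
     (\<forall>X \<in> carrier_mat n n. \<Phi> X \<in> carrier_mat m m) \<and>
     (\<forall>X \<in> carrier_mat n n. \<forall>Y \<in> carrier_mat n n. \<Phi> (X + Y) = \<Phi> X + \<Phi> Y) \<and>
     (\<forall>c. \<forall>X \<in> carrier_mat n n. \<Phi> (c \<cdot>\<^sub>m X) = c \<cdot>\<^sub>m \<Phi> X)"

definition k_positive ::
  "nat \<Rightarrow> nat \<Rightarrow> nat \<Rightarrow> (complex mat \<Rightarrow> complex mat) \<Rightarrow> bool" where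
  "k_positive n m k \<Phi> \<longleftrightarrow> linear_mat_map n m \<Phi> \<and>
     (\<forall>A. (\<forall>i<k. \<forall>j<k. A i j \<in> carrier_mat n n) \<longrightarrow> pos_semidef (block_matrix k n A) \<longrightarrow>
          pos_semidef (block_matrix k m (\<lambda>i j. \<Phi> (A i j))))"

definition k_copositive ::
  "nat \<Rightarrow> nat \<Rightarrow> nat \<Rightarrow> (complex mat \<Rightarrow> complex mat) \<Rightarrow> bool" where
  "k_copositive n m k \<Phi> \<longleftrightarrow> k_positive n m k (\<Phi> \<circ> transpose_mat)"

(* The square roots of the eigenvalues of B^* B (counted with algebraic multiplicity), in
   decreasing order.  B^* B has dim_col B eigenvalues; if dim_row B < dim_col B the surplus
   ones, which are 0, are cut off. *)
definition singular_values :: "complex mat \<Rightarrow> real list" where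
  "singular_values B = take (min (dim_row B) (dim_col B))
     (rev (sorted_list_of_multiset
       (image_mset (\<lambda>z. sqrt (Re z)) (proots (char_poly (mat_adjoint B * B))))))"

(* Singular values are numbered from 1; meaningful for 1 \<le> i \<le> min (dim_row B) (dim_col B). *)
definition singular_value :: "nat \<Rightarrow> complex mat \<Rightarrow> real" ("\<sigma>") where
  "\<sigma> i B = singular_values B ! (i - 1)"

definition Phi_plus :: "real \<Rightarrow> complex mat \<Rightarrow> complex mat \<Rightarrow> complex mat" where
  "Phi_plus \<alpha> B X =
     (complex_of_real \<alpha> * mat_trace X) \<cdot>\<^sub>m 1\<^sub>m (dim_row B) + B * X * mat_adjoint B"

end

theory Submission
  imports Defs "HOL-Combinatorics.List_Permutation"
begin

text \<open>Write a positive semidefinite block matrix as a sum of rank-one matrices \<open>a a\<^sup>*\<close>. For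
  such a summand and a vector \<open>v\<close>, with \<open>a\<close> and \<open>v\<close> split into \<open>k\<close> blocks, the quadratic form
  of the image block matrix depends only on the \<open>m \<times> n\<close> matrix \<open>Y\<close> obtained by pairing the
  blocks, an arbitrary matrix of rank at most \<open>k\<close>: it equals \<open>\<alpha> \<parallel>Y\<parallel>\<^sup>2 + tr (N (cnj N))\<close> with \<open>N
  = Y\<^sup>T B\<close> (\<open>pairing\<close> and \<open>twist\<close> below are the entries of \<open>Y\<close> and \<open>N\<close>). If \<open>k = 1\<close> then \<open>N\<close>
  has rank at most one and the trace is a squared modulus. In general, passing to right
  singular vectors makes the columns of \<open>B\<close> orthogonal, and Bessel's inequality bounds the
  trace below by \<open>- \<sigma>\<^sub>1 \<sigma>\<^sub>2 \<parallel>Y\<parallel>\<^sup>2\<close>; an antisymmetric \<open>Y\<close> of rank two attains this bound. The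
  case of \<open>rank B \<le> 1\<close> is the one where \<open>\<sigma>\<^sub>1 \<sigma>\<^sub>2 = 0\<close>.\<close>

section \<open>Unitary diagonalization\<close>

lemma mat_adjoint_eq:
  fixes A :: "complex mat"
  shows "mat_adjoint A = mat (dim_col A) (dim_row A) (\<lambda>(i, j). cnj (A $$ (j, i)))"
  by (rule eq_matI) (auto simp: mat_adjoint_def mat_of_rows_index)

lemma mat_adjoint_carrier [simp]:
  fixes A :: "complex mat"
  shows "A \<in> carrier_mat r c \<Longrightarrow> mat_adjoint A \<in> carrier_mat c r"
  by (simp add: mat_adjoint_eq)

lemma mat_adjoint_dim [simp]:
  fixes A :: "complex mat"
  shows "dim_row (mat_adjoint A) = dim_col A" "dim_col (mat_adjoint A) = dim_row A"
  by (simp_all add: mat_adjoint_eq)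

lemma mat_adjoint_index [simp]:
  fixes A :: "complex mat"
  shows "i < dim_col A \<Longrightarrow> j < dim_row A \<Longrightarrow> mat_adjoint A $$ (i, j) = cnj (A $$ (j, i))"
  by (simp add: mat_adjoint_eq)

lemma mat_mult_index_sum:
  assumes "A \<in> carrier_mat r c" "B \<in> carrier_mat c e" "i < r" "j < e"
  shows "(A * B) $$ (i, j) = (\<Sum>l<c. A $$ (i, l) * B $$ (l, j))"
  using assms by (simp add: scalar_prod_def lessThan_atLeast0)

lemma mat_adjoint_mult:
  fixes A B :: "complex mat"
  assumes "A \<in> carrier_mat r c" "B \<in> carrier_mat c e"
  shows "mat_adjoint (A * B) = mat_adjoint B * mat_adjoint A"
  using assms by (intro eq_matI) (auto simp: scalar_prod_def mult.commute)

lemma mat_adjoint_adjoint [simp]: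
  fixes A :: "complex mat"
  shows "mat_adjoint (mat_adjoint A) = A"
  by (intro eq_matI) auto

text \<open>Complete \<open>v\<close> to a basis, orthogonalize it by Gram-Schmidt, which keeps the
  first vector, and normalize. This supplies the deflation step of the diagonalization
  below.\<close>

lemma unitary_with_first_column:
  fixes v :: "complex vec"
  assumes v: "v \<in> carrier_vec n" and v0: "v \<noteq> 0\<^sub>v n" and n: "n \<noteq> 0"
  obtains W where "W \<in> carrier_mat n n" "mat_adjoint W * W = 1\<^sub>m n" "W * mat_adjoint W = 1\<^sub>m n"
    "\<exists>c. col W 0 = c \<cdot>\<^sub>v v"
proof -
  interpret cof_vec_space n "TYPE(complex)" .
  define b where "b = basis_completion v"
  define ws where "ws = gram_schmidt n b"
  from basis_completion[OF v v0, folded b_def]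
  have dist_b: "distinct b" and indep: "\<not> lin_dep (set b)" and b: "set b \<subseteq> carrier_vec n"
    and hdb: "hd b = v" and len_b: "length b = n" by auto
  from hdb len_b n obtain vs where bv: "b = v # vs" by (cases b) auto
  from gram_schmidt_result[OF b dist_b indep refl, folded ws_def]
  have ws: "set ws \<subseteq> carrier_vec n" "corthogonal ws" "length ws = n"
    by (auto simp: len_b)
  from gram_schmidt_hd[OF v, of vs, folded bv] have hdws: "hd ws = v" unfolding ws_def .
  then have ws0: "ws ! 0 = v" using ws(3) n by (metis hd_conv_nth list.size(3))
  have dim: "ws ! i \<in> carrier_vec n" if "i < n" for i using ws that by auto
  \<comment> \<open>\<open>gram_schmidt\<close> yields orthogonal vectors that are not normalized;
    \<open>q i\<close> is the squared norm to be divided out.\<close>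
  define q where "q i = (\<Sum>r<n. (cmod (ws ! i $ r))\<^sup>2)" for i
  have sq: "ws ! i \<bullet>c ws ! i = of_real (q i)" if "i < n" for i
    using dim[OF that]
    by (simp add: scalar_prod_def q_def lessThan_atLeast0 flip: complex_norm_square)
  have qpos: "q i > 0" if "i < n" for i
  proof -
    have "ws ! i \<bullet>c ws ! i \<noteq> 0" using corthogonalD[OF ws(2), of i i] that ws(3) by simp
    then have "q i \<noteq> 0" using sq[OF that] by auto
    moreover have "q i \<ge> 0" by (simp add: q_def sum_nonneg)
    ultimately show ?thesis by simp
  qed
  define W where "W = mat n n (\<lambda>(r, i). ws ! i $ r / of_real (sqrt (q i)))"
  have W: "W \<in> carrier_mat n n" by (simp add: W_def)
  have WW: "mat_adjoint W * W = 1\<^sub>m n"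
  proof (rule eq_matI)
    fix i j assume "i < dim_row (1\<^sub>m n :: complex mat)" "j < dim_col (1\<^sub>m n :: complex mat)"
    then have i: "i < n" and j: "j < n" by auto
    have "(mat_adjoint W * W) $$ (i, j) = (\<Sum>r<n. cnj (W $$ (r, i)) * W $$ (r, j))"
      using i j W by (simp add: scalar_prod_def lessThan_atLeast0)
    also have "\<dots> = (\<Sum>r<n. ws ! j $ r * cnj (ws ! i $ r)) / of_real (sqrt (q i) * sqrt (q j))"
      unfolding sum_divide_distrib
      by (rule sum.cong) (use i j in \<open>auto simp: W_def mult.commute\<close>)
    also have "(\<Sum>r<n. ws ! j $ r * cnj (ws ! i $ r)) = ws ! j \<bullet>c ws ! i"
      using dim[OF i] by (simp add: scalar_prod_def lessThan_atLeast0)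
    also have "\<dots> / of_real (sqrt (q i) * sqrt (q j)) = (if i = j then 1 else 0)"
      using corthogonalD[OF ws(2), of j i] i j ws(3) sq[OF i] qpos[OF i]
    by (auto simp flip: of_real_mult)
    finally show "(mat_adjoint W * W) $$ (i, j) = 1\<^sub>m n $$ (i, j)" using i j by simp
  qed (use W in auto)
  have "W * mat_adjoint W = 1\<^sub>m n"
    by (rule mat_mult_left_right_inverse[OF _ W WW]) (use W in auto)
  moreover have "col W 0 = (1 / of_real (sqrt (q 0))) \<cdot>\<^sub>v v"
    using n v by (intro eq_vecI) (auto simp: W_def ws0)
  ultimately show ?thesis using that W WW by blast
qed

text \<open>Induction by deflation. Conjugating with a unitary whose first column is an eigenvector
  clears the first column below the diagonal, Hermitian symmetry then clears the first row and makes
  the eigenvalue real, and the induction hypothesis handles the remaining block.\<close>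

lemma hermitian_unitary_diagonalization:
  fixes A :: "complex mat"
  assumes "A \<in> carrier_mat n n" "mat_adjoint A = A"
  shows "\<exists>U d. U \<in> carrier_mat n n \<and> mat_adjoint U * U = 1\<^sub>m n \<and> U * mat_adjoint U = 1\<^sub>m n \<and>
    mat_adjoint U * A * U = mat n n (\<lambda>(i, j). if i = j then complex_of_real (d i) else 0)"
  using assms
proof (induction n arbitrary: A)
  case 0
  show ?case by (rule exI[of _ "1\<^sub>m 0"]) (use 0 in \<open>auto intro!: eq_matI\<close>)
next
  case (Suc n)
  note A = Suc.prems(1)
  obtain e where "e \<in> spectrum A" using spectrum_non_empty[OF A] by auto
  then obtain v where v: "v \<in> carrier_vec (Suc n)" "v \<noteq> 0\<^sub>v (Suc n)" "A *\<^sub>v v = e \<cdot>\<^sub>v v"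
    using A by (auto simp: spectrum_def eigenvalue_def eigenvector_def)
  obtain W c where W: "W \<in> carrier_mat (Suc n) (Suc n)" "mat_adjoint W * W = 1\<^sub>m (Suc n)"
      "W * mat_adjoint W = 1\<^sub>m (Suc n)" "col W 0 = c \<cdot>\<^sub>v v"
    using unitary_with_first_column[OF v(1,2)] by blast
  define A' where "A' = mat_adjoint W * A * W"
  have A': "A' \<in> carrier_mat (Suc n) (Suc n)" using A W by (auto simp: A'_def intro!: mult_carrier_mat)
  have herm: "mat_adjoint A' = A'"
    using A W Suc.prems(2) by (simp add: A'_def mat_adjoint_mult[of _ "Suc n" "Suc n" _ "Suc n"]
        assoc_mult_mat[of _ "Suc n" "Suc n" _ "Suc n" _ "Suc n"]
        mult_carrier_mat[of _ "Suc n" "Suc n" _ "Suc n"])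
  have "A *\<^sub>v col W 0 = e \<cdot>\<^sub>v col W 0"
    using v A W(4) by (simp add: mult_mat_vec smult_smult_assoc mult.commute)
  have "col A' 0 = (mat_adjoint W * A) *\<^sub>v col W 0"
    unfolding A'_def using A W by (intro col_mult2) auto
  also have "\<dots> = mat_adjoint W *\<^sub>v (A *\<^sub>v col W 0)"
    using A W(1) by (intro assoc_mult_mat_vec) (auto intro!: col_carrier_vec)
  also have "\<dots> = e \<cdot>\<^sub>v (mat_adjoint W *\<^sub>v col W 0)"
    unfolding \<open>A *\<^sub>v col W 0 = _\<close> using W(1) by (intro mult_mat_vec) auto
  also have "mat_adjoint W *\<^sub>v col W 0 = col (mat_adjoint W * W) 0"
    using W(1) by (intro col_mult2[symmetric]) auto
  finally have col0: "col A' 0 = e \<cdot>\<^sub>v col (1\<^sub>m (Suc n)) 0" using W(2) by simp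
  have A'0: "A' $$ (i, 0) = (if i = 0 then e else 0)" if "i < Suc n" for i
    using arg_cong[OF col0, of "\<lambda>v. v $ i"] that A' by simp
  have A'h: "A' $$ (i, j) = cnj (A' $$ (j, i))" if "i < Suc n" "j < Suc n" for i j
    using arg_cong[OF herm, of "\<lambda>M. M $$ (i, j)"] that A' by simp
  have e: "cnj e = e" using A'h[of 0 0] A'0[of 0] by simp
  have A'0r: "A' $$ (0, j) = (if j = 0 then e else 0)" if "j < Suc n" for j
    by (subst A'h) (use A'0[OF that] e that in simp_all)
  \<comment> \<open>The lower right block is again Hermitian, so the induction hypothesis applies to
    it.\<close>
  define A3 where "A3 = mat n n (\<lambda>(i, j). A' $$ (Suc i, Suc j))"
  have A3: "A3 \<in> carrier_mat n n" by (simp add: A3_def)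
  have "mat_adjoint A3 = A3"
    by (rule eq_matI) (auto simp: A3_def intro: A'h[symmetric])
  from Suc.IH[OF A3 this] obtain U d where U: "U \<in> carrier_mat n n" "mat_adjoint U * U = 1\<^sub>m n"
      "mat_adjoint U * A3 * U = mat n n (\<lambda>(i, j). if i = j then complex_of_real (d i) else 0)"
    by blast
  \<comment> \<open>\<open>F\<close> lets \<open>U\<close> act on the last \<open>n\<close>
    coordinates and fixes the first; the diagonalizing unitary is \<open>W * F\<close>.\<close>
  define F where "F = four_block_mat (1\<^sub>m 1) (0\<^sub>m 1 n) (0\<^sub>m n 1) U"
  have F: "F \<in> carrier_mat (Suc n) (Suc n)"
    using U(1) unfolding F_def by (metis four_block_carrier_mat one_carrier_mat plus_1_eq_Suc)
  have Fadj: "mat_adjoint F = four_block_mat (1\<^sub>m 1) (0\<^sub>m 1 n) (0\<^sub>m n 1) (mat_adjoint U)"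
    by (rule eq_matI) (use U(1) in \<open>auto simp: F_def\<close>)
  have A'4: "A' = four_block_mat (mat 1 1 (\<lambda>_. e)) (0\<^sub>m 1 n) (0\<^sub>m n 1) A3"
  proof (rule eq_matI)
    fix i j assume "i < dim_row (four_block_mat (mat 1 1 (\<lambda>_. e)) (0\<^sub>m 1 n) (0\<^sub>m n 1) A3)"
      "j < dim_col (four_block_mat (mat 1 1 (\<lambda>_. e)) (0\<^sub>m 1 n) (0\<^sub>m n 1) A3)"
    then have "i < Suc n" "j < Suc n" using A3 by auto
    then show "A' $$ (i, j) = four_block_mat (mat 1 1 (\<lambda>_. e)) (0\<^sub>m 1 n) (0\<^sub>m n 1) A3 $$ (i, j)"
      using A3 A'0[of i] A'0r[of j]
      by (cases i; cases j) (auto simp: A3_def)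
  qed (use A' A3 in auto)
  have FF: "mat_adjoint F * F = 1\<^sub>m (Suc n)"
    unfolding Fadj unfolding F_def
    by (subst mult_four_block_mat[of _ 1 1 _ n _ n _ _ 1 _ n])
       (use U in \<open>auto intro!: eq_matI\<close>)
  define d' where "d' i = (case i of 0 \<Rightarrow> Re e | Suc j \<Rightarrow> d j)" for i
  have e': "e = complex_of_real (Re e)" using e by (simp add: complex_eq_iff)
  have FAF: "mat_adjoint F * A' * F
      = mat (Suc n) (Suc n) (\<lambda>(i, j). if i = j then complex_of_real (d' i) else 0)"
  proof -
    have UA: "mat_adjoint U * A3 \<in> carrier_mat n n" "mat_adjoint U * A3 * U \<in> carrier_mat n n"
      using U(1) A3 by (auto intro!: mult_carrier_mat)
    have "mat_adjoint F * A' * F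
       = four_block_mat (mat 1 1 (\<lambda>_. e)) (0\<^sub>m 1 n) (0\<^sub>m n 1) (mat_adjoint U * A3 * U)"
      unfolding Fadj A'4 unfolding F_def
      apply (subst mult_four_block_mat[of _ 1 1 _ n _ n _ _ 1 _ n]; (use U(1) A3 UA in simp)?)
      apply (subst mult_four_block_mat[of _ 1 1 _ n _ n _ _ 1 _ n]; (use U(1) A3 UA in simp)?)
      done
    also have "\<dots> = mat (Suc n) (Suc n) (\<lambda>(i, j). if i = j then complex_of_real (d' i) else 0)"
      unfolding U(3) by (rule eq_matI) (use e'[symmetric] in \<open>auto simp: d'_def split: nat.splits\<close>)
    finally show ?thesis .
  qed
  define P where "P = W * F"
  have P: "P \<in> carrier_mat (Suc n) (Suc n)" using W F by (simp add: P_def)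
  note assoc = assoc_mult_mat[of _ "Suc n" "Suc n" _ "Suc n" _ "Suc n"]
    mult_carrier_mat[of _ "Suc n" "Suc n" _ "Suc n"]
  have Padj: "mat_adjoint P = mat_adjoint F * mat_adjoint W"
    unfolding P_def using W(1) F by (rule mat_adjoint_mult)
  have "mat_adjoint P * P = mat_adjoint F * ((mat_adjoint W * W) * F)"
    unfolding Padj unfolding P_def using W(1) F by (simp add: assoc)
  then have PP: "mat_adjoint P * P = 1\<^sub>m (Suc n)" using W F FF by simp
  moreover have "P * mat_adjoint P = 1\<^sub>m (Suc n)"
    by (rule mat_mult_left_right_inverse[OF _ P PP]) (use P in auto)
  moreover have "mat_adjoint P * A * P = mat_adjoint F * A' * F"
    unfolding Padj unfolding P_def A'_def using W(1) F A by (simp add: assoc)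
  ultimately have "P \<in> carrier_mat (Suc n) (Suc n) \<and> mat_adjoint P * P = 1\<^sub>m (Suc n) \<and>
      P * mat_adjoint P = 1\<^sub>m (Suc n) \<and> mat_adjoint P * A * P
        = mat (Suc n) (Suc n) (\<lambda>(i, j). if i = j then complex_of_real (d' i) else 0)"
    using P FAF by (intro conjI) simp_all
  then show ?case by blast
qed

section \<open>The form on rectangular matrices\<close>

definition twist :: "nat \<Rightarrow> (nat \<Rightarrow> nat \<Rightarrow> complex) \<Rightarrow> (nat \<Rightarrow> nat \<Rightarrow> complex) \<Rightarrow> nat \<Rightarrow> nat \<Rightarrow> complex" where
  "twist m b y r q = (\<Sum>p<m. b p q * y p r)"

text \<open>The value is real by \<open>cnj_swapped_sum_real\<close> but is kept complex, because
  \<open>pos_semidef\<close> compares complex numbers with 0.\<close>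

definition qform :: "nat \<Rightarrow> nat \<Rightarrow> real \<Rightarrow> (nat \<Rightarrow> nat \<Rightarrow> complex) \<Rightarrow> (nat \<Rightarrow> nat \<Rightarrow> complex) \<Rightarrow> complex" where
  "qform m n \<alpha> b y = of_real (\<alpha> * (\<Sum>p<m. \<Sum>q<n. (cmod (y p q))\<^sup>2))
     + (\<Sum>r<n. \<Sum>q<n. twist m b y r q * cnj (twist m b y q r))"

lemma of_real_sum_cmod_square:
  "of_real (\<Sum>i\<in>A. (cmod (f i))\<^sup>2) = (\<Sum>i\<in>A. f i * cnj (f i))"
  by (simp only: of_real_sum complex_norm_square)

text \<open>The squared norm of \<open>y\<close> minus its projection \<open>z\<close> onto the span
  of the conjugated columns is nonnegative. The conjugates enter because the sums pair
  \<open>x p j\<close> with \<open>y p\<close> bilinearly, as \<open>twist\<close> does.\<close>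

lemma Bessel_sum:
  fixes x :: "nat \<Rightarrow> nat \<Rightarrow> complex" and y :: "nat \<Rightarrow> complex"
  assumes orth: "\<And>i j. i \<in> J \<Longrightarrow> j \<in> J \<Longrightarrow> (\<Sum>p<m. x p i * cnj (x p j)) = (if i = j then 1 else 0)"
    and J: "finite J"
  shows "(\<Sum>j\<in>J. (cmod (\<Sum>p<m. x p j * y p))\<^sup>2) \<le> (\<Sum>p<m. (cmod (y p))\<^sup>2)"
proof -
  define c where "c j = (\<Sum>p<m. x p j * y p)" for j
  define z where "z p = (\<Sum>j\<in>J. c j * cnj (x p j))" for p
  have 1: "(\<Sum>p<m. y p * cnj (z p)) = (\<Sum>j\<in>J. c j * cnj (c j))"
  proof -
    have "(\<Sum>p<m. y p * cnj (z p)) = (\<Sum>p<m. \<Sum>j\<in>J. y p * x p j * cnj (c j))"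
      by (simp add: z_def sum_distrib_left mult_ac)
    also have "\<dots> = (\<Sum>j\<in>J. \<Sum>p<m. y p * x p j * cnj (c j))" by (rule sum.swap)
    also have "\<dots> = (\<Sum>j\<in>J. c j * cnj (c j))"
      by (rule sum.cong[OF refl], subst (2) c_def) (simp add: sum_distrib_left sum_distrib_right mult_ac)
    finally show ?thesis .
  qed
  have 2: "(\<Sum>p<m. z p * cnj (z p)) = (\<Sum>j\<in>J. c j * cnj (c j))"
  proof -
    have "(\<Sum>p<m. z p * cnj (z p)) = (\<Sum>p<m. \<Sum>j\<in>J. \<Sum>i\<in>J. c j * cnj (c i) * (x p i * cnj (x p j)))"
      by (simp add: z_def sum_product mult_ac)
    also have "\<dots> = (\<Sum>j\<in>J. \<Sum>i\<in>J. \<Sum>p<m. c j * cnj (c i) * (x p i * cnj (x p j)))"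
      by (subst sum.swap, rule sum.cong[OF refl], rule sum.swap)
    also have "\<dots> = (\<Sum>j\<in>J. \<Sum>i\<in>J. c j * cnj (c i) * (if i = j then 1 else 0))"
      by (intro sum.cong refl) (simp only: orth flip: sum_distrib_left)
    also have "\<dots> = (\<Sum>j\<in>J. c j * cnj (c j))"
      using J by (simp add: if_distrib sum.delta cong: if_cong)
    finally show ?thesis .
  qed
  have "complex_of_real (\<Sum>p<m. (cmod (y p - z p))\<^sup>2) = (\<Sum>p<m. (y p - z p) * cnj (y p - z p))"
    by (rule of_real_sum_cmod_square)
  also have "\<dots> = (\<Sum>p<m. y p * cnj (y p)) - (\<Sum>p<m. y p * cnj (z p)) - cnj (\<Sum>p<m. y p * cnj (z p)) + (\<Sum>p<m. z p * cnj (z p))"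
    by (simp add: algebra_simps sum.distrib sum_subtractf)
  also have "\<dots> = (\<Sum>p<m. y p * cnj (y p)) - (\<Sum>j\<in>J. c j * cnj (c j))"
    unfolding 1 2 by (simp add: mult.commute)
  also have "\<dots> = of_real ((\<Sum>p<m. (cmod (y p))\<^sup>2) - (\<Sum>j\<in>J. (cmod (c j))\<^sup>2))"
    by (simp only: of_real_diff of_real_sum_cmod_square)
  finally have "(\<Sum>p<m. (cmod (y p - z p))\<^sup>2) = (\<Sum>p<m. (cmod (y p))\<^sup>2) - (\<Sum>j\<in>J. (cmod (c j))\<^sup>2)"
    unfolding of_real_eq_iff .
  moreover have "0 \<le> (\<Sum>p<m. (cmod (y p - z p))\<^sup>2)" by (simp add: sum_nonneg)
  ultimately show ?thesis by (simp add: c_def)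
qed

text \<open>Conjugation merely exchanges the two summation indices.\<close>

lemma cnj_swapped_sum_real:
  fixes f :: "nat \<Rightarrow> nat \<Rightarrow> complex"
  shows "(\<Sum>r<n. \<Sum>q<n. f r q * cnj (f q r)) = of_real (Re (\<Sum>r<n. \<Sum>q<n. f r q * cnj (f q r)))"
proof -
  define z where "z = (\<Sum>r<n. \<Sum>q<n. f r q * cnj (f q r))"
  have "cnj z = (\<Sum>r<n. \<Sum>q<n. f q r * cnj (f r q))"
    by (simp add: z_def mult.commute)
  also have "\<dots> = z" unfolding z_def by (rule sum.swap)
  finally have "z = of_real (Re z)" by (simp add: complex_eq_iff)
  then show ?thesis unfolding z_def .
qed

text \<open>Dividing the columns by their norms and applying Bessel's inequality replaces the
  off-diagonal products of \<open>twist\<close> by products of two norms times square-summable factors.\<close>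

lemma qform_nonneg_orthogonal_columns:
  fixes x y :: "nat \<Rightarrow> nat \<Rightarrow> complex" and s :: "nat \<Rightarrow> real"
  assumes orth: "\<And>i j. i < n \<Longrightarrow> j < n \<Longrightarrow>
      (\<Sum>p<m. x p i * cnj (x p j)) = (if i = j then of_real ((s i)\<^sup>2) else 0)"
    and s: "\<And>i. i < n \<Longrightarrow> s i \<ge> 0"
    and \<alpha>: "\<alpha> \<ge> 0" "\<And>i j. i < n \<Longrightarrow> j < n \<Longrightarrow> i \<noteq> j \<Longrightarrow> s i * s j \<le> \<alpha>"
  shows "0 \<le> qform m n \<alpha> x y"
proof -
  define N where "N = twist m x y"
  \<comment> \<open>The default 0 is harmless: if \<open>s q = 0\<close>, column \<open>q\<close> of
    \<open>x\<close> vanishes and so does \<open>N r q\<close>, hence \<open>Nt\<close> holds in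
    both cases.\<close>
  define t where "t r q = (if s q = 0 then 0 else cmod (N r q) / s q)" for r q
  have t0: "t r q \<ge> 0" if "q < n" for r q using s[OF that] by (simp add: t_def)
  have Nt: "cmod (N r q) = s q * t r q" if "q < n" for r q
  proof (cases "s q = 0")
    case True
    then have "(\<Sum>p<m. x p q * cnj (x p q)) = 0" using orth[OF that that] by simp
    then have "of_real (\<Sum>p<m. (cmod (x p q))\<^sup>2) = (0 :: complex)"
      by (simp only: of_real_sum_cmod_square)
    then have "(\<Sum>p<m. (cmod (x p q))\<^sup>2) = 0" unfolding of_real_eq_0_iff .
    then have "\<forall>p<m. x p q = 0" by (subst (asm) sum_nonneg_eq_0_iff) auto
    then show ?thesis using True by (simp add: N_def twist_def)
  qed (simp add: t_def)
  have bess: "(\<Sum>q<n. (t r q)\<^sup>2) \<le> (\<Sum>p<m. (cmod (y p r))\<^sup>2)" for r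
  proof -
    \<comment> \<open>Only columns of nonzero norm can be normalized to an orthonormal
      system.\<close>
    define J where "J = {q. q < n \<and> s q \<noteq> 0}"
    have "(\<Sum>q<n. (t r q)\<^sup>2) = (\<Sum>q\<in>J. (t r q)\<^sup>2)"
      by (rule sum.mono_neutral_right) (auto simp: J_def t_def)
    also have "\<dots> = (\<Sum>q\<in>J. (cmod (\<Sum>p<m. (x p q / of_real (s q)) * y p r))\<^sup>2)"
    proof (rule sum.cong[OF refl])
      fix q assume q: "q \<in> J"
      have "(\<Sum>p<m. (x p q / of_real (s q)) * y p r) = N r q / of_real (s q)"
        by (simp add: N_def twist_def sum_divide_distrib)
      then show "(t r q)\<^sup>2 = (cmod (\<Sum>p<m. (x p q / of_real (s q)) * y p r))\<^sup>2"
        using q s by (simp add: J_def t_def norm_divide)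
    qed
    also have "\<dots> \<le> (\<Sum>p<m. (cmod (y p r))\<^sup>2)"
    proof (rule Bessel_sum)
      fix i j assume ij: "i \<in> J" "j \<in> J"
      have "(\<Sum>p<m. x p i / of_real (s i) * cnj (x p j / of_real (s j)))
          = (\<Sum>p<m. x p i * cnj (x p j)) / (of_real (s i) * of_real (s j))"
        by (simp add: sum_divide_distrib)
      then show "(\<Sum>p<m. x p i / of_real (s i) * cnj (x p j / of_real (s j))) = (if i = j then 1 else 0)"
        using orth[of i j] ij by (auto simp: J_def power2_eq_square)
    qed (simp add: J_def)
    finally show ?thesis .
  qed
  \<comment> \<open>A diagonal term is a squared modulus. An off-diagonal one has modulus
    \<open>s r * s q * (t r q * t q r)\<close>, and the inequality of arithmetic and geometric means
    splits the last product.\<close>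
  have termwise: "- \<alpha> * (((t r q)\<^sup>2 + (t q r)\<^sup>2) / 2) \<le> Re (N r q * cnj (N q r))"
    if rq: "r < n" "q < n" for r q
  proof (cases "r = q")
    case True
    have "N r r * cnj (N r r) = of_real ((cmod (N r r))\<^sup>2)" by (rule complex_norm_square[symmetric])
    then have "Re (N r q * cnj (N q r)) = (cmod (N r r))\<^sup>2" using True by (metis Re_complex_of_real)
    then have "0 \<le> Re (N r q * cnj (N q r))" by simp
    moreover have "- \<alpha> * (((t r q)\<^sup>2 + (t q r)\<^sup>2) / 2) \<le> 0" using \<alpha>(1) by simp
    ultimately show ?thesis by linarith
  next
    case False
    have "\<bar>Re (N r q * cnj (N q r))\<bar> \<le> cmod (N r q) * cmod (N q r)"
      using abs_Re_le_cmod[of "N r q * cnj (N q r)"] by (simp add: norm_mult)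
    also have "\<dots> = (s r * s q) * (t r q * t q r)" using rq by (simp add: Nt)
    also have "\<dots> \<le> \<alpha> * (t r q * t q r)"
      using \<alpha>(2)[OF rq False] t0 rq by (intro mult_right_mono) auto
    also have "\<dots> \<le> \<alpha> * (((t r q)\<^sup>2 + (t q r)\<^sup>2) / 2)"
      using \<alpha>(1) sum_squares_bound[of "t r q" "t q r"] by (intro mult_left_mono) auto
    finally show ?thesis by linarith
  qed
  \<comment> \<open>Both halves have the same sum over all pairs, and \<open>bess\<close> bounds it:
    row \<open>r\<close> of \<open>t\<close> against column \<open>r\<close> of
    \<open>y\<close>.\<close>
  have "(\<Sum>r<n. \<Sum>q<n. ((t r q)\<^sup>2 + (t q r)\<^sup>2) / 2) = (\<Sum>r<n. \<Sum>q<n. (t r q)\<^sup>2)"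
    using sum.swap[of "\<lambda>r q. (t r q)\<^sup>2" "{..<n}" "{..<n}"]
    by (simp add: add_divide_distrib sum.distrib flip: sum_divide_distrib)
  also have "\<dots> \<le> (\<Sum>r<n. \<Sum>p<m. (cmod (y p r))\<^sup>2)"
    by (intro sum_mono bess)
  also have "\<dots> = (\<Sum>p<m. \<Sum>q<n. (cmod (y p q))\<^sup>2)" by (rule sum.swap)
  finally have le: "(\<Sum>r<n. \<Sum>q<n. ((t r q)\<^sup>2 + (t q r)\<^sup>2) / 2) \<le> (\<Sum>p<m. \<Sum>q<n. (cmod (y p q))\<^sup>2)" .
  have "- \<alpha> * (\<Sum>p<m. \<Sum>q<n. (cmod (y p q))\<^sup>2) \<le> - \<alpha> * (\<Sum>r<n. \<Sum>q<n. ((t r q)\<^sup>2 + (t q r)\<^sup>2) / 2)"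
    using le \<alpha>(1) by (simp add: mult_left_mono)
  also have "\<dots> = (\<Sum>r<n. \<Sum>q<n. - \<alpha> * (((t r q)\<^sup>2 + (t q r)\<^sup>2) / 2))"
    by (simp only: sum_distrib_left)
  also have "\<dots> \<le> (\<Sum>r<n. \<Sum>q<n. Re (N r q * cnj (N q r)))"
    by (intro sum_mono termwise) auto
  also have "\<dots> = Re (\<Sum>r<n. \<Sum>q<n. N r q * cnj (N q r))" by simp
  finally have "0 \<le> \<alpha> * (\<Sum>p<m. \<Sum>q<n. (cmod (y p q))\<^sup>2) + Re (\<Sum>r<n. \<Sum>q<n. N r q * cnj (N q r))"
    by linarith
  then show ?thesis
    unfolding qform_def N_def[symmetric]
    by (subst cnj_swapped_sum_real) (simp only: less_eq_complex_def Re_complex_of_real Im_complex_of_real plus_complex.simps zero_complex.simps simp_thms add_0_left)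
qed

section \<open>Unitary invariance of the form and its values on special matrices\<close>

text \<open>Parseval: the rows of \<open>u\<close> are orthonormal, so multiplication by
  \<open>u\<close> preserves inner products.\<close>

lemma sum_kronecker_contract:
  fixes u :: "nat \<Rightarrow> nat \<Rightarrow> complex"
  assumes u: "\<And>r s. r < n \<Longrightarrow> s < n \<Longrightarrow> (\<Sum>i<n. u r i * cnj (u s i)) = (if r = s then 1 else 0)"
  shows "(\<Sum>i<n. (\<Sum>r<n. f r * u r i) * cnj (\<Sum>r<n. g r * u r i)) = (\<Sum>r<n. f r * cnj (g r))"
proof -
  have "(\<Sum>i<n. (\<Sum>r<n. f r * u r i) * cnj (\<Sum>r<n. g r * u r i))
      = (\<Sum>i<n. \<Sum>r<n. \<Sum>s<n. f r * cnj (g s) * (u r i * cnj (u s i)))"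
    by (simp add: sum_product mult_ac)
  also have "\<dots> = (\<Sum>r<n. \<Sum>s<n. \<Sum>i<n. f r * cnj (g s) * (u r i * cnj (u s i)))"
    by (subst sum.swap, rule sum.cong[OF refl], rule sum.swap)
  also have "\<dots> = (\<Sum>r<n. \<Sum>s<n. f r * cnj (g s) * (if r = s then 1 else 0))"
    by (intro sum.cong refl) (simp only: u lessThan_iff flip: sum_distrib_left)
  also have "\<dots> = (\<Sum>r<n. f r * cnj (g r))"
    by (simp add: if_distrib cong: if_cong)
  finally show ?thesis .
qed

text \<open>Passing from B and Y to B u and Y u preserves the norm of Y and turns N into u^T N u.
  The trace of N times its conjugate is invariant under this congruence, since the conjugate of u
  times u^T is the identity.\<close>

lemma qform_unitary:
  fixes u :: "nat \<Rightarrow> nat \<Rightarrow> complex"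
  assumes u: "\<And>r s. r < n \<Longrightarrow> s < n \<Longrightarrow> (\<Sum>i<n. u r i * cnj (u s i)) = (if r = s then 1 else 0)"
  shows "qform m n \<alpha> (\<lambda>p i. \<Sum>q<n. b p q * u q i) (\<lambda>p i. \<Sum>q<n. y p q * u q i) = qform m n \<alpha> b y"
proof -
  have "of_real (\<Sum>i<n. (cmod (\<Sum>q<n. y p q * u q i))\<^sup>2) = (\<Sum>q<n. y p q * cnj (y p q))" for p
    unfolding of_real_sum_cmod_square by (rule sum_kronecker_contract[OF u])
  also have "(\<Sum>q<n. y p q * cnj (y p q)) = of_real (\<Sum>q<n. (cmod (y p q))\<^sup>2)" for p
    by (rule of_real_sum_cmod_square[symmetric])
  finally have 1: "(\<Sum>i<n. (cmod (\<Sum>q<n. y p q * u q i))\<^sup>2) = (\<Sum>q<n. (cmod (y p q))\<^sup>2)" for p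
    unfolding of_real_eq_iff .
  define N where "N = twist m b y"
  define N' where "N' = twist m (\<lambda>p i. \<Sum>q<n. b p q * u q i) (\<lambda>p i. \<Sum>q<n. y p q * u q i)"
  have N': "N' i j = (\<Sum>r<n. (\<Sum>q<n. N r q * u q j) * u r i)" for i j
  proof -
    have "N' i j = (\<Sum>p<m. \<Sum>r<n. \<Sum>q<n. b p q * u q j * (y p r * u r i))"
      by (simp add: N'_def twist_def sum_product) (intro sum.cong refl sum.swap)
    also have "\<dots> = (\<Sum>r<n. \<Sum>q<n. \<Sum>p<m. b p q * u q j * (y p r * u r i))"
      by (subst sum.swap, rule sum.cong[OF refl], rule sum.swap)
    also have "\<dots> = (\<Sum>r<n. (\<Sum>q<n. N r q * u q j) * u r i)"
      by (simp add: N_def twist_def sum_distrib_right sum_distrib_left mult_ac)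
    finally show ?thesis .
  qed
  \<comment> \<open>With the other bracketing, used for the conjugated factor \<open>N' j i\<close>,
    both factors are expansions in \<open>u r i\<close>; the contraction then runs first over
    \<open>i\<close> and afterwards over \<open>j\<close>.\<close>
  have N'2: "N' i j = (\<Sum>q<n. (\<Sum>r<n. N r q * u r i) * u q j)" for i j
    unfolding N' sum_distrib_right by (subst sum.swap) (simp add: mult_ac)
  have "(\<Sum>i<n. \<Sum>j<n. N' i j * cnj (N' j i))
      = (\<Sum>j<n. \<Sum>i<n. (\<Sum>r<n. (\<Sum>q<n. N r q * u q j) * u r i) * cnj (\<Sum>r<n. (\<Sum>q<n. N q r * u q j) * u r i))"
    by (subst sum.swap, intro sum.cong refl arg_cong2[where f = "(*)"] arg_cong[where f = cnj] N' N'2)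
  also have "\<dots> = (\<Sum>j<n. \<Sum>r<n. (\<Sum>q<n. N r q * u q j) * cnj (\<Sum>q<n. N q r * u q j))"
    by (intro sum.cong refl sum_kronecker_contract[OF u])
  also have "\<dots> = (\<Sum>r<n. \<Sum>j<n. (\<Sum>q<n. N r q * u q j) * cnj (\<Sum>q<n. N q r * u q j))"
    by (rule sum.swap)
  also have "\<dots> = (\<Sum>r<n. \<Sum>q<n. N r q * cnj (N q r))"
    by (intro sum.cong refl sum_kronecker_contract[OF u])
  finally show ?thesis unfolding qform_def N_def N'_def 1 by simp
qed

lemma twist_rank_one:
  "twist m b (\<lambda>p q. a q * c p) r q = a r * (\<Sum>p<m. b p q * c p)"
  by (simp add: twist_def sum_distrib_left mult_ac)

text \<open>For \<open>Y\<close> of rank one the double sum is a product of a number and its own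
  conjugate. This serves both the case of \<open>k = 1\<close> and the necessity of \<alpha> \<ge>
  0.\<close>

lemma qform_rank_one:
  "qform m n \<alpha> b (\<lambda>p q. a q * c p)
    = of_real (\<alpha> * ((\<Sum>p<m. (cmod (c p))\<^sup>2) * (\<Sum>q<n. (cmod (a q))\<^sup>2))
       + (cmod (\<Sum>r<n. a r * cnj (\<Sum>p<m. b p r * c p)))\<^sup>2)"
proof -
  have "(\<Sum>r<n. \<Sum>q<n. (a r * (\<Sum>p<m. b p q * c p)) * cnj (a q * (\<Sum>p<m. b p r * c p)))
      = (\<Sum>r<n. a r * cnj (\<Sum>p<m. b p r * c p)) * cnj (\<Sum>r<n. a r * cnj (\<Sum>p<m. b p r * c p))"
    by (simp only: sum_product cnj_sum complex_cnj_mult complex_cnj_cnj) (simp only: mult_ac)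
  moreover have "(\<Sum>p<m. \<Sum>q<n. (cmod (a q * c p))\<^sup>2) = (\<Sum>p<m. (cmod (c p))\<^sup>2) * (\<Sum>q<n. (cmod (a q))\<^sup>2)"
    by (simp only: norm_mult power_mult_distrib sum_product mult.commute[of "(cmod (a _))\<^sup>2"])
  ultimately show ?thesis
    unfolding qform_def twist_rank_one by (simp only: of_real_add complex_norm_square)
qed

text \<open>The extremal matrix: its columns \<open>i\<close> and \<open>j\<close> are the
  normalized conjugates of the columns \<open>j\<close> and \<open>i\<close> of \<open>x\<close>,
  one with a minus sign. Its squared norm is 2, and \<open>twist\<close> has only the entries
  \<open>s j\<close> at \<open>(i, j)\<close> and \<open>- s i\<close> at
  \<open>(j, i)\<close>.\<close>

lemma qform_antisymmetric:
  fixes x :: "nat \<Rightarrow> nat \<Rightarrow> complex" and s :: "nat \<Rightarrow> real"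
  assumes orthx: "\<And>i j. i < n \<Longrightarrow> j < n \<Longrightarrow>
      (\<Sum>p<m. x p i * cnj (x p j)) = (if i = j then of_real ((s i)\<^sup>2) else 0)"
    and pos: "s i > 0" "s j > 0" and ij: "i < n" "j < n" "i \<noteq> j"
  shows "qform m n \<alpha> x (\<lambda>p q. (if q = i then 1 else 0) * (cnj (x p j) / of_real (s j))
      + (if q = j then 1 else 0) * (- cnj (x p i) / of_real (s i))) = of_real (2 * \<alpha> - 2 * (s i * s j))"
proof -
  define y where "y p q = (if q = i then 1 else 0) * (cnj (x p j) / of_real (s j))
      + (if q = j then 1 else 0) * (- cnj (x p i) / of_real (s i))" for p q
  have tw: "twist m x y r q = (if r = i \<and> q = j then of_real (s j)
      else if r = j \<and> q = i then - of_real (s i) else 0)" if "r < n" "q < n" for r q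
  proof -
    have "twist m x y r q = (if r = i then 1 else 0) * ((\<Sum>p<m. x p q * cnj (x p j)) / of_real (s j))
      - (if r = j then 1 else 0) * ((\<Sum>p<m. x p q * cnj (x p i)) / of_real (s i))"
      using ij by (auto simp: twist_def y_def sum_divide_distrib sum_negf)
    then show ?thesis using orthx that ij pos by (auto simp: power2_eq_square)
  qed
  have norm: "(\<Sum>p<m. (cmod (x p l))\<^sup>2) = (s l)\<^sup>2" if "l < n" for l
  proof -
    have "of_real (\<Sum>p<m. (cmod (x p l))\<^sup>2) = complex_of_real ((s l)\<^sup>2)"
      using orthx[OF that that] unfolding of_real_sum_cmod_square by simp
    then show ?thesis unfolding of_real_eq_iff .
  qed
  have "(\<Sum>p<m. \<Sum>q<n. (cmod (y p q))\<^sup>2) = (\<Sum>q<n. \<Sum>p<m. (cmod (y p q))\<^sup>2)" by (rule sum.swap)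
  also have "\<dots> = (\<Sum>q<n. (if q = i then 1 else 0) + (if q = j then 1 else 0))"
  proof (rule sum.cong[OF refl])
    fix q assume "q \<in> {..<n}"
    show "(\<Sum>p<m. (cmod (y p q))\<^sup>2) = (if q = i then 1 else 0) + (if q = j then 1 else 0)"
      using norm ij pos
      by (auto simp: y_def norm_divide power_divide simp flip: sum_divide_distrib)
  qed
  also have "\<dots> = 2" using ij by (simp add: sum.distrib)
  finally have 1: "(\<Sum>p<m. \<Sum>q<n. (cmod (y p q))\<^sup>2) = 2" .
  have "(\<Sum>r<n. \<Sum>q<n. twist m x y r q * cnj (twist m x y q r))
      = (\<Sum>r<n. \<Sum>q<n. (if q = j then if r = i then - of_real (s i * s j) else 0 else 0)
          + (if q = i then if r = j then - of_real (s i * s j) else 0 else 0))"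
    by (intro sum.cong refl) (use ij in \<open>auto simp: tw\<close>)
  also have "\<dots> = - of_real (2 * (s i * s j))"
    using ij by (simp add: sum.distrib)
  finally have 2: "(\<Sum>r<n. \<Sum>q<n. twist m x y r q * cnj (twist m x y q r)) = - of_real (2 * (s i * s j))" .
  show ?thesis unfolding y_def[symmetric] qform_def 1 2 by simp
qed

section \<open>Reduction to rank-one blocks\<close>

lemma unitary_entries:
  fixes U :: "complex mat"
  assumes U: "U \<in> carrier_mat n n" "mat_adjoint U * U = 1\<^sub>m n" "U * mat_adjoint U = 1\<^sub>m n"
    and ij: "i < n" "j < n"
  shows "(\<Sum>r<n. U $$ (r, i) * cnj (U $$ (r, j))) = (if i = j then 1 else 0)"
    and "(\<Sum>r<n. U $$ (i, r) * cnj (U $$ (j, r))) = (if i = j then 1 else 0)"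
proof -
  have "(mat_adjoint U * U) $$ (j, i) = (\<Sum>r<n. U $$ (r, i) * cnj (U $$ (r, j)))"
    using U(1) ij by (subst mat_mult_index_sum[of _ n n]) (auto simp: mult.commute)
  then show "(\<Sum>r<n. U $$ (r, i) * cnj (U $$ (r, j))) = (if i = j then 1 else 0)"
    unfolding U(2) using ij by auto
  have "(U * mat_adjoint U) $$ (i, j) = (\<Sum>r<n. U $$ (i, r) * cnj (U $$ (j, r)))"
    using U(1) ij by (subst mat_mult_index_sum[of _ n n]) auto
  then show "(\<Sum>r<n. U $$ (i, r) * cnj (U $$ (j, r))) = (if i = j then 1 else 0)"
    unfolding U(3) using ij by auto
qed

lemma unitary_conjugate_inverse:
  fixes A U D :: "complex mat"
  assumes A: "A \<in> carrier_mat n n" and U: "U \<in> carrier_mat n n" "U * mat_adjoint U = 1\<^sub>m n"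
    and D: "mat_adjoint U * A * U = D"
  shows "A = U * D * mat_adjoint U"
proof -
  note carrier = mult_carrier_mat[of _ n n _ n] mat_adjoint_carrier[of _ n n]
  note assoc = assoc_mult_mat[of _ n n _ n _ n]
  have "U * D * mat_adjoint U = (U * mat_adjoint U) * A * (U * mat_adjoint U)"
    unfolding D[symmetric] using A U(1) by (simp add: assoc carrier)
  then show ?thesis using A U by simp
qed

text \<open>Similarity to a diagonal matrix preserves the characteristic polynomial. This links the
  numbers \<open>d\<close> of the diagonalization, with multiplicity, to the roots in
  \<open>singular_values\<close>.\<close>

lemma unitary_diagonal_char_poly:
  fixes A U :: "complex mat"
  assumes A: "A \<in> carrier_mat n n"
    and U: "U \<in> carrier_mat n n" "mat_adjoint U * U = 1\<^sub>m n" "U * mat_adjoint U = 1\<^sub>m n"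
    and D: "mat_adjoint U * A * U = mat n n (\<lambda>(i, j). if i = j then complex_of_real (d i) else 0)"
  shows "char_poly A = (\<Prod>i\<leftarrow>[0..<n]. [:- complex_of_real (d i), 1:])"
proof -
  define D where "D = mat n n (\<lambda>(i, j). if i = j then complex_of_real (d i) else 0)"
  have Dc: "D \<in> carrier_mat n n" by (simp add: D_def)
  have "similar_mat_wit A D U (mat_adjoint U)"
    by (rule similar_mat_witI[OF U(3,2) _ A Dc U(1)])
      (use unitary_conjugate_inverse[OF A U(1,3) D] U in \<open>auto simp: D_def\<close>)
  then have "char_poly A = char_poly D"
    by (intro char_poly_similar) (auto simp: similar_mat_def)
  also have "\<dots> = (\<Prod>a\<leftarrow>diag_mat D. [:- a, 1:])"
    by (rule char_poly_upper_triangular[OF Dc]) (auto simp: D_def upper_triangular_def)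
  also have "diag_mat D = map (\<lambda>i. complex_of_real (d i)) [0..<n]"
    by (auto simp: diag_mat_def D_def)
  finally show ?thesis by (simp add: o_def)
qed

lemma quadratic_form_sum:
  fixes A :: "complex mat"
  assumes "A \<in> carrier_mat N N" "v \<in> carrier_vec N"
  shows "(A *\<^sub>v v) \<bullet>c v = (\<Sum>x<N. \<Sum>y<N. A $$ (x, y) * v $ y * cnj (v $ x))"
  using assms by (simp add: scalar_prod_def lessThan_atLeast0 sum_distrib_right)

text \<open>Spectral decomposition: the eigenvalues are nonnegative, so their square roots can be
  absorbed into the eigenvectors.\<close>

lemma pos_semidef_sum_rank_one:
  assumes A: "A \<in> carrier_mat N N" and psd: "pos_semidef A"
  shows "\<exists>a :: nat \<Rightarrow> nat \<Rightarrow> complex. \<forall>x<N. \<forall>y<N. A $$ (x, y) = (\<Sum>l<N. a l x * cnj (a l y))"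
proof -
  obtain U d where U: "U \<in> carrier_mat N N" "mat_adjoint U * U = 1\<^sub>m N" "U * mat_adjoint U = 1\<^sub>m N"
    and D: "mat_adjoint U * A * U = mat N N (\<lambda>(i, j). if i = j then complex_of_real (d i) else 0)"
    using hermitian_unitary_diagonalization[OF A] psd unfolding pos_semidef_def by blast
  \<comment> \<open>\<open>d l\<close> is the value of the quadratic form at the \<open>l\<close>-th
    column of \<open>U\<close>.\<close>
  have d: "d l \<ge> 0" if l: "l < N" for l
  proof -
    have c: "col U l \<in> carrier_vec N" using U(1) by (auto intro: col_carrier_vec)
    have "complex_of_real (d l) = (mat_adjoint U * A * U) $$ (l, l)" using D l by simp
    also have "\<dots> = (\<Sum>y<N. (\<Sum>x<N. cnj (U $$ (x, l)) * A $$ (x, y)) * U $$ (y, l))"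
    proof (subst mat_mult_index_sum[of _ N N])
      show "(\<Sum>y<N. (mat_adjoint U * A) $$ (l, y) * U $$ (y, l))
          = (\<Sum>y<N. (\<Sum>x<N. cnj (U $$ (x, l)) * A $$ (x, y)) * U $$ (y, l))"
        by (rule sum.cong[OF refl], subst mat_mult_index_sum[of _ N N]) (use U(1) A l in auto)
    qed (use U(1) A l in \<open>auto intro!: mult_carrier_mat\<close>)
    also have "\<dots> = (\<Sum>x<N. \<Sum>y<N. A $$ (x, y) * U $$ (y, l) * cnj (U $$ (x, l)))"
      unfolding sum_distrib_right by (subst sum.swap) (simp add: mult_ac)
    also have "\<dots> = (A *\<^sub>v col U l) \<bullet>c col U l"
      using U(1) l by (subst quadratic_form_sum[OF A c]) simp
    also have "\<dots> \<ge> 0" using psd c A by (simp add: pos_semidef_def)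
    finally show ?thesis by (simp add: less_eq_complex_def)
  qed
  define a where "a l x = U $$ (x, l) * complex_of_real (sqrt (d l))" for l x
  have "A $$ (x, y) = (\<Sum>l<N. a l x * cnj (a l y))" if xy: "x < N" "y < N" for x y
  proof -
    define D where "D = mat N N (\<lambda>(i, j). if i = j then complex_of_real (d i) else 0)"
    have Dc: "D \<in> carrier_mat N N" by (simp add: D_def)
    have UD: "(U * D) $$ (x, l) = U $$ (x, l) * of_real (d l)" if "l < N" for l
    proof -
      have "(U * D) $$ (x, l) = (\<Sum>j<N. U $$ (x, j) * D $$ (j, l))"
        by (rule mat_mult_index_sum[OF U(1) Dc xy(1) that])
      also have "\<dots> = (\<Sum>j<N. if j = l then U $$ (x, j) * of_real (d j) else 0)"
        by (rule sum.cong) (use that in \<open>auto simp: D_def\<close>)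
      finally show ?thesis using that by simp
    qed
    have "A = U * D * mat_adjoint U"
      by (rule unitary_conjugate_inverse[OF A U(1,3)]) (simp add: D D_def)
    then have "A $$ (x, y) = (\<Sum>l<N. (U * D) $$ (x, l) * mat_adjoint U $$ (l, y))"
      using mat_mult_index_sum[of "U * D" N N "mat_adjoint U" N x y] U(1) Dc xy by simp
    also have "\<dots> = (\<Sum>l<N. a l x * cnj (a l y))"
    proof (rule sum.cong[OF refl])
      fix l assume "l \<in> {..<N}"
      then have l: "l < N" by simp
      have "complex_of_real (d l) = of_real (sqrt (d l)) * of_real (sqrt (d l))"
        using d[OF l] by (simp flip: of_real_mult)
      then show "(U * D) $$ (x, l) * mat_adjoint U $$ (l, y) = a l x * cnj (a l y)"
        using U(1) l xy by (simp add: UD a_def)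
    qed
    finally show ?thesis .
  qed
  then show ?thesis by (intro exI[of _ a]) simp
qed

section \<open>Quadratic forms with block indices\<close>

lemma sum_block:
  fixes f :: "nat \<Rightarrow> 'a::comm_monoid_add"
  shows "(\<Sum>x<k * d. f x) = (\<Sum>i<k. \<Sum>p<d. f (i * d + p))"
proof -
  have "(\<Sum>x<k * d. f x) = (\<Sum>i<k. sum f {i * d..<i * d + d})"
    by (rule sum.nat_group[symmetric])
  also have "\<dots> = (\<Sum>i<k. \<Sum>p<d. f (i * d + p))"
  proof (rule sum.cong[OF refl])
    fix i
    show "sum f {i * d..<i * d + d} = (\<Sum>p<d. f (i * d + p))"
      by (rule sum.reindex_bij_witness[of _ "\<lambda>p. i * d + p" "\<lambda>x. x - i * d"]) auto
  qed
  finally show ?thesis .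
qed

text \<open>Each summand separates in \<open>x\<close> and \<open>y\<close>, so these sums can move
  inside. Treating \<open>(p, q)\<close> as a single index reduces this to two interchanges.\<close>

lemma sum_bilinear_factor:
  fixes f g :: "nat \<Rightarrow> nat \<Rightarrow> nat \<Rightarrow> complex"
  shows "(\<Sum>x<N. \<Sum>y<N. \<Sum>p<m. \<Sum>q<n. f x p q * g y p q)
    = (\<Sum>p<m. \<Sum>q<n. (\<Sum>x<N. f x p q) * (\<Sum>y<N. g y p q))"
proof -
  have "(\<Sum>x<N. \<Sum>y<N. \<Sum>p<m. \<Sum>q<n. f x p q * g y p q)
      = (\<Sum>x<N. \<Sum>y<N. \<Sum>z\<in>{..<m} \<times> {..<n}. f x (fst z) (snd z) * g y (fst z) (snd z))"
    by (simp add: sum.cartesian_product case_prod_unfold)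
  also have "\<dots> = (\<Sum>x<N. \<Sum>z\<in>{..<m} \<times> {..<n}. \<Sum>y<N. f x (fst z) (snd z) * g y (fst z) (snd z))"
    by (intro sum.cong refl sum.swap)
  also have "\<dots> = (\<Sum>z\<in>{..<m} \<times> {..<n}. \<Sum>x<N. \<Sum>y<N. f x (fst z) (snd z) * g y (fst z) (snd z))"
    by (rule sum.swap)
  also have "\<dots> = (\<Sum>z\<in>{..<m} \<times> {..<n}.
      (\<Sum>x<N. f x (fst z) (snd z)) * (\<Sum>y<N. g y (fst z) (snd z)))"
    by (simp only: sum_product)
  also have "\<dots> = (\<Sum>p<m. \<Sum>q<n. (\<Sum>x<N. f x p q) * (\<Sum>y<N. g y p q))"
    by (simp add: sum.cartesian_product case_prod_unfold)
  finally show ?thesis .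
qed

text \<open>The sum over \<open>i\<close> of the rank-one matrices formed from the conjugated
  \<open>i\<close>-th block of \<open>v\<close> (length \<open>m\<close>) and the
  \<open>i\<close>-th block of \<open>a\<close> (length \<open>n\<close>).\<close>

definition pairing :: "nat \<Rightarrow> nat \<Rightarrow> nat \<Rightarrow> (nat \<Rightarrow> complex) \<Rightarrow> (nat \<Rightarrow> complex) \<Rightarrow> nat \<Rightarrow> nat \<Rightarrow> complex" where
  "pairing k m n a v p q = (\<Sum>i<k. a (i * n + q) * cnj (v (i * m + p)))"

text \<open>The left side is the quadratic form at \<open>v\<close> of the image of the block matrix
  \<open>a a\<^sup>*\<close>. Both parts of its entries separate in \<open>x\<close> and
  \<open>y\<close>: \<open>e\<close> serves the trace part and \<open>f\<close> the part with B. The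
  transposition pairs \<open>f x r q\<close> with \<open>f y q r\<close>, which is why N meets its
  conjugate with indices exchanged.\<close>

lemma qform_eq_quadratic_form:
  assumes m: "0 < m"
  shows "(\<Sum>x<k * m. \<Sum>y<k * m.
      ((if x mod m = y mod m
          then of_real \<alpha> * (\<Sum>q<n. a (x div m * n + q) * cnj (a (y div m * n + q))) else 0)
        + (\<Sum>r<n. \<Sum>q<n. b (x mod m) q * (a (x div m * n + r) * cnj (a (y div m * n + q)))
            * cnj (b (y mod m) r))) * v y * cnj (v x))
    = qform m n \<alpha> b (pairing k m n a v)"
proof -
  \<comment> \<open>Summing over \<open>p\<close> encodes the condition
    \<open>x mod m = y mod m\<close> as a product of a factor in \<open>x\<close> and a factor in
    \<open>y\<close>.\<close>
  define e where "e x p q = (if x mod m = p then a (x div m * n + q) * cnj (v x) else 0)" for x p q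
  define f where "f x r q = b (x mod m) q * a (x div m * n + r) * cnj (v x)" for x r q
  have e_sum: "(\<Sum>x<k * m. e x p q) = pairing k m n a v p q" if "p < m" for p q
    unfolding sum_block pairing_def
  proof (rule sum.cong[OF refl])
    fix i
    have "(\<Sum>s<m. e (i * m + s) p q)
        = (\<Sum>s<m. if s = p then a (i * n + q) * cnj (v (i * m + s)) else 0)"
      by (rule sum.cong[OF refl]) (auto simp: e_def)
    then show "(\<Sum>s<m. e (i * m + s) p q) = a (i * n + q) * cnj (v (i * m + p))"
      using that by simp
  qed
  have f_sum: "(\<Sum>x<k * m. f x r q) = twist m b (pairing k m n a v) r q" for r q
  proof -
    have "(\<Sum>x<k * m. f x r q) = (\<Sum>i<k. \<Sum>p<m. b p q * (a (i * n + r) * cnj (v (i * m + p))))"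
      unfolding sum_block by (intro sum.cong refl) (simp add: f_def mult_ac)
    also have "\<dots> = (\<Sum>p<m. \<Sum>i<k. b p q * (a (i * n + r) * cnj (v (i * m + p))))"
      by (rule sum.swap)
    finally show ?thesis by (simp add: twist_def pairing_def sum_distrib_left)
  qed
  have entry: "((if x mod m = y mod m
          then of_real \<alpha> * (\<Sum>q<n. a (x div m * n + q) * cnj (a (y div m * n + q))) else 0)
        + (\<Sum>r<n. \<Sum>q<n. b (x mod m) q * (a (x div m * n + r) * cnj (a (y div m * n + q)))
            * cnj (b (y mod m) r))) * v y * cnj (v x)
      = of_real \<alpha> * (\<Sum>p<m. \<Sum>q<n. e x p q * cnj (e y p q)) + (\<Sum>r<n. \<Sum>q<n. f x r q * cnj (f y q r))"
    for x y
  proof -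
    have "(\<Sum>p<m. \<Sum>q<n. e x p q * cnj (e y p q))
       = (\<Sum>p<m. if p = x mod m then (if x mod m = y mod m then
           (\<Sum>q<n. a (x div m * n + q) * cnj (a (y div m * n + q))) * v y * cnj (v x) else 0) else 0)"
      by (rule sum.cong[OF refl]) (auto simp: e_def sum_distrib_left sum_distrib_right mult_ac)
    also have "\<dots> = (if x mod m = y mod m then
           (\<Sum>q<n. a (x div m * n + q) * cnj (a (y div m * n + q))) * v y * cnj (v x) else 0)"
      using m by simp
    finally have 1: "of_real \<alpha> * (\<Sum>p<m. \<Sum>q<n. e x p q * cnj (e y p q))
      = (if x mod m = y mod m then of_real \<alpha> *
           (\<Sum>q<n. a (x div m * n + q) * cnj (a (y div m * n + q))) else 0) * v y * cnj (v x)"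
      by simp
    have 2: "(\<Sum>r<n. \<Sum>q<n. f x r q * cnj (f y q r))
      = (\<Sum>r<n. \<Sum>q<n. b (x mod m) q * (a (x div m * n + r) * cnj (a (y div m * n + q)))
            * cnj (b (y mod m) r)) * v y * cnj (v x)"
      by (simp add: f_def sum_distrib_left sum_distrib_right mult_ac)
    show ?thesis unfolding 1 2 by (simp only: distrib_right)
  qed
  have "(\<Sum>x<k * m. \<Sum>y<k * m. of_real \<alpha> * (\<Sum>p<m. \<Sum>q<n. e x p q * cnj (e y p q))
        + (\<Sum>r<n. \<Sum>q<n. f x r q * cnj (f y q r)))
      = of_real \<alpha> * (\<Sum>p<m. \<Sum>q<n. (\<Sum>x<k * m. e x p q) * cnj (\<Sum>x<k * m. e x p q))
        + (\<Sum>r<n. \<Sum>q<n. (\<Sum>x<k * m. f x r q) * cnj (\<Sum>x<k * m. f x q r))"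
    by (simp only: sum.distrib sum_distrib_left[symmetric] sum_bilinear_factor cnj_sum)
  also have "(\<Sum>p<m. \<Sum>q<n. (\<Sum>x<k * m. e x p q) * cnj (\<Sum>x<k * m. e x p q))
      = of_real (\<Sum>p<m. \<Sum>q<n. (cmod (pairing k m n a v p q))\<^sup>2)"
    by (simp add: e_sum of_real_sum_cmod_square del: of_real_sum add: of_real_sum[of _ "{..<m}"])
  finally show ?thesis
    unfolding entry f_sum qform_def by (simp only: of_real_mult)
qed

section \<open>The map on block matrices\<close>

lemma Phi_plus_carrier:
  "B \<in> carrier_mat m n \<Longrightarrow> X \<in> carrier_mat n n \<Longrightarrow> Phi_plus \<alpha> B X \<in> carrier_mat m m"
  by (auto simp: Phi_plus_def intro!: add_carrier_mat mult_carrier_mat)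

lemma Phi_plus_transpose_entry:
  assumes B: "B \<in> carrier_mat m n" and X: "X \<in> carrier_mat n n" and ps: "p < m" "s < m"
  shows "(Phi_plus \<alpha> B \<circ> transpose_mat) X $$ (p, s)
    = (if p = s then of_real \<alpha> * (\<Sum>q<n. X $$ (q, q)) else 0)
      + (\<Sum>r<n. \<Sum>q<n. B $$ (p, q) * X $$ (r, q) * cnj (B $$ (s, r)))"
proof -
  have BX: "B * transpose_mat X \<in> carrier_mat m n" using B X by auto
  have "(B * transpose_mat X * mat_adjoint B) $$ (p, s)
      = (\<Sum>r<n. (B * transpose_mat X) $$ (p, r) * mat_adjoint B $$ (r, s))"
    by (rule mat_mult_index_sum[OF BX _ ps]) (use B in auto)
  also have "\<dots> = (\<Sum>r<n. \<Sum>q<n. B $$ (p, q) * X $$ (r, q) * cnj (B $$ (s, r)))"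
  proof (rule sum.cong[OF refl])
    fix r assume "r \<in> {..<n}"
    then have r: "r < n" by simp
    have "(B * transpose_mat X) $$ (p, r) = (\<Sum>q<n. B $$ (p, q) * transpose_mat X $$ (q, r))"
      by (rule mat_mult_index_sum[OF B _ ps(1) r]) (use X in auto)
    also have "\<dots> = (\<Sum>q<n. B $$ (p, q) * X $$ (r, q))"
      by (rule sum.cong) (use X r in auto)
    finally show "(B * transpose_mat X) $$ (p, r) * mat_adjoint B $$ (r, s)
        = (\<Sum>q<n. B $$ (p, q) * X $$ (r, q) * cnj (B $$ (s, r)))"
      using B r ps by (simp add: sum_distrib_right)
  qed
  finally have "(B * transpose_mat X * mat_adjoint B) $$ (p, s)
      = (\<Sum>r<n. \<Sum>q<n. B $$ (p, q) * X $$ (r, q) * cnj (B $$ (s, r)))" .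
  moreover have "mat_trace (transpose_mat X) = (\<Sum>q<n. X $$ (q, q))"
    using X by (simp add: mat_trace_def)
  ultimately show ?thesis
    using B X ps by (simp add: Phi_plus_def)
qed

lemma linear_mat_map_Phi_plus_transpose:
  assumes B: "B \<in> carrier_mat m n"
  shows "linear_mat_map n m (Phi_plus \<alpha> B \<circ> transpose_mat)"
proof -
  have carrier: "(Phi_plus \<alpha> B \<circ> transpose_mat) X \<in> carrier_mat m m" if "X \<in> carrier_mat n n" for X
    using Phi_plus_carrier[OF B, of "transpose_mat X"] that by simp
  note dims = carrier[THEN carrier_matD(1)] carrier[THEN carrier_matD(2)]
  note entry = Phi_plus_transpose_entry[OF B]
  show ?thesis
    unfolding linear_mat_map_def
  proof (intro conjI ballI allI)
    fix X Y :: "complex mat" assume X: "X \<in> carrier_mat n n" and Y: "Y \<in> carrier_mat n n"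
    have XY: "X + Y \<in> carrier_mat n n" using X Y by simp
    show "(Phi_plus \<alpha> B \<circ> transpose_mat) (X + Y)
        = (Phi_plus \<alpha> B \<circ> transpose_mat) X + (Phi_plus \<alpha> B \<circ> transpose_mat) Y" (is "?L = ?R")
    proof (rule eq_matI)
      fix p s assume "p < dim_row ?R" "s < dim_col ?R"
      then have ps: "p < m" "s < m" using dims[OF Y] by auto
      have "?L $$ (p, s) = (Phi_plus \<alpha> B \<circ> transpose_mat) X $$ (p, s) + (Phi_plus \<alpha> B \<circ> transpose_mat) Y $$ (p, s)"
        unfolding entry[OF X ps] entry[OF Y ps] entry[OF XY ps]
        using X Y by (simp add: sum.distrib algebra_simps)
      then show "?L $$ (p, s) = ?R $$ (p, s)" using ps dims[OF X] dims[OF Y] by simp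
    qed (use dims[OF X] dims[OF Y] dims[OF XY] in simp_all)
  next
    fix c and X :: "complex mat" assume X: "X \<in> carrier_mat n n"
    have cX: "c \<cdot>\<^sub>m X \<in> carrier_mat n n" using X by simp
    show "(Phi_plus \<alpha> B \<circ> transpose_mat) (c \<cdot>\<^sub>m X) = c \<cdot>\<^sub>m (Phi_plus \<alpha> B \<circ> transpose_mat) X" (is "?L = ?R")
    proof (rule eq_matI)
      fix p s assume "p < dim_row ?R" "s < dim_col ?R"
      then have ps: "p < m" "s < m" using dims[OF X] by auto
      have "?L $$ (p, s) = c * (Phi_plus \<alpha> B \<circ> transpose_mat) X $$ (p, s)"
        unfolding entry[OF X ps] entry[OF cX ps]
        using X by (simp add: sum_distrib_left algebra_simps)
      then show "?L $$ (p, s) = ?R $$ (p, s)" using ps dims[OF X] by simp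
    qed (use dims[OF X] dims[OF cX] in simp_all)
  qed (rule carrier)
qed

lemma div_mod_block:
  fixes x :: nat
  assumes "x < k * d"
  shows "x div d < k" "x mod d < d"
  using assms by (cases "d = 0"; simp add: less_mult_imp_div_less)+

lemma block_index_less:
  fixes i :: nat
  assumes "i < k" "p < d"
  shows "i * d + p < k * d"
proof -
  have "i * d + p < i * d + d" using assms by simp
  also have "\<dots> \<le> k * d" using assms by (metis Suc_leI mult_Suc mult_le_mono1 add.commute)
  finally show ?thesis .
qed

text \<open>Everything is linear in the block matrix, so each rank-one summand contributes its own
  \<open>qform\<close>. It is applied with a single summand and with a full spectral
  decomposition.\<close>

lemma block_quadratic_form:
  fixes a :: "nat \<Rightarrow> nat \<Rightarrow> complex" and v :: "nat \<Rightarrow> complex"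
  assumes B: "B \<in> carrier_mat m n" and m: "0 < m"
    and A: "\<And>i j. i < k \<Longrightarrow> j < k \<Longrightarrow> A i j \<in> carrier_mat n n"
    and entries: "\<And>i j r q. i < k \<Longrightarrow> j < k \<Longrightarrow> r < n \<Longrightarrow> q < n \<Longrightarrow>
      A i j $$ (r, q) = (\<Sum>l<L. a l (i * n + r) * cnj (a l (j * n + q)))"
  shows "(\<Sum>x<k * m. \<Sum>y<k * m.
      block_matrix k m (\<lambda>i j. (Phi_plus \<alpha> B \<circ> transpose_mat) (A i j)) $$ (x, y) * v y * cnj (v x))
    = (\<Sum>l<L. qform m n \<alpha> (\<lambda>p q. B $$ (p, q)) (pairing k m n (a l) v))"
proof -
  define E where "E l x y =
      (if x mod m = y mod m
          then of_real \<alpha> * (\<Sum>q<n. a l (x div m * n + q) * cnj (a l (y div m * n + q))) else 0)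
        + (\<Sum>r<n. \<Sum>q<n. B $$ (x mod m, q) * (a l (x div m * n + r) * cnj (a l (y div m * n + q)))
            * cnj (B $$ (y mod m, r)))" for l x y
  have entry: "block_matrix k m (\<lambda>i j. (Phi_plus \<alpha> B \<circ> transpose_mat) (A i j)) $$ (x, y) = (\<Sum>l<L. E l x y)"
    if x: "x < k * m" and y: "y < k * m" for x y
  proof -
    note xd = div_mod_block[OF x] and yd = div_mod_block[OF y]
    let ?X = "A (x div m) (y div m)"
    have 1: "(\<Sum>q<n. ?X $$ (q, q)) = (\<Sum>l<L. \<Sum>q<n. a l (x div m * n + q) * cnj (a l (y div m * n + q)))"
      by (subst sum.swap) (intro sum.cong refl entries xd yd, auto)
    have "(\<Sum>r<n. \<Sum>q<n. B $$ (x mod m, q) * ?X $$ (r, q) * cnj (B $$ (y mod m, r)))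
      = (\<Sum>r<n. \<Sum>q<n. \<Sum>l<L. B $$ (x mod m, q) * (a l (x div m * n + r) * cnj (a l (y div m * n + q)))
          * cnj (B $$ (y mod m, r)))"
      by (intro sum.cong refl) (simp add: entries xd yd sum_distrib_left sum_distrib_right)
    also have "\<dots> = (\<Sum>r<n. \<Sum>l<L. \<Sum>q<n. B $$ (x mod m, q) * (a l (x div m * n + r) * cnj (a l (y div m * n + q)))
          * cnj (B $$ (y mod m, r)))"
      by (intro sum.cong refl sum.swap)
    also have "\<dots> = (\<Sum>l<L. \<Sum>r<n. \<Sum>q<n. B $$ (x mod m, q) * (a l (x div m * n + r) * cnj (a l (y div m * n + q)))
          * cnj (B $$ (y mod m, r)))"
      by (rule sum.swap)
    finally have 2: "(\<Sum>r<n. \<Sum>q<n. B $$ (x mod m, q) * ?X $$ (r, q) * cnj (B $$ (y mod m, r))) = \<dots>" .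
    have "block_matrix k m (\<lambda>i j. (Phi_plus \<alpha> B \<circ> transpose_mat) (A i j)) $$ (x, y)
        = (Phi_plus \<alpha> B \<circ> transpose_mat) ?X $$ (x mod m, y mod m)"
      using x y by (simp add: block_matrix_def)
    also have "\<dots> = (\<Sum>l<L. E l x y)"
      unfolding Phi_plus_transpose_entry[OF B A[OF xd(1) yd(1)] xd(2) yd(2)] 1 2 E_def
      by (cases "x mod m = y mod m") (simp_all only: if_True if_False simp_thms sum.distrib sum_distrib_left sum.neutral_const)
    finally show ?thesis .
  qed
  have "(\<Sum>x<k * m. \<Sum>y<k * m.
      block_matrix k m (\<lambda>i j. (Phi_plus \<alpha> B \<circ> transpose_mat) (A i j)) $$ (x, y) * v y * cnj (v x))
     = (\<Sum>x<k * m. \<Sum>y<k * m. \<Sum>l<L. E l x y * v y * cnj (v x))"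
    by (intro sum.cong refl) (simp only: lessThan_iff entry sum_distrib_right)
  also have "\<dots> = (\<Sum>x<k * m. \<Sum>l<L. \<Sum>y<k * m. E l x y * v y * cnj (v x))"
    by (intro sum.cong refl sum.swap)
  also have "\<dots> = (\<Sum>l<L. \<Sum>x<k * m. \<Sum>y<k * m. E l x y * v y * cnj (v x))"
    by (rule sum.swap)
  also have "\<dots> = (\<Sum>l<L. qform m n \<alpha> (\<lambda>p q. B $$ (p, q)) (pairing k m n (a l) v))"
    unfolding E_def by (intro sum.cong refl qform_eq_quadratic_form[OF m])
  finally show ?thesis .
qed

lemma block_matrix_carrier: "block_matrix k d A \<in> carrier_mat (k * d) (k * d)"
  by (simp add: block_matrix_def)

text \<open>\<open>pos_semidef\<close> demands this besides the sign of the form. Conjugating the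
  entry formula of block \<open>(j, i)\<close> exchanges the roles of \<open>r\<close> and
  \<open>q\<close>, and an interchange of sums restores the order.\<close>

lemma block_Phi_plus_hermitian:
  assumes B: "B \<in> carrier_mat m n"
    and A: "\<And>i j. i < k \<Longrightarrow> j < k \<Longrightarrow> A i j \<in> carrier_mat n n"
    and herm: "\<And>i j r q. i < k \<Longrightarrow> j < k \<Longrightarrow> r < n \<Longrightarrow> q < n \<Longrightarrow> A i j $$ (r, q) = cnj (A j i $$ (q, r))"
  shows "mat_adjoint (block_matrix k m (\<lambda>i j. (Phi_plus \<alpha> B \<circ> transpose_mat) (A i j)))
    = block_matrix k m (\<lambda>i j. (Phi_plus \<alpha> B \<circ> transpose_mat) (A i j))" (is "mat_adjoint ?G = ?G")
proof (rule eq_matI)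
  have G: "?G \<in> carrier_mat (k * m) (k * m)" by (rule block_matrix_carrier)
  fix x y assume "x < dim_row ?G" "y < dim_col ?G"
  then have x: "x < k * m" and y: "y < k * m" using G by auto
  note xd = div_mod_block[OF x] and yd = div_mod_block[OF y]
  let ?i = "x div m" and ?j = "y div m" and ?p = "x mod m" and ?s = "y mod m"
  have "cnj ((Phi_plus \<alpha> B \<circ> transpose_mat) (A ?j ?i) $$ (?s, ?p))
     = (if ?s = ?p then of_real \<alpha> * (\<Sum>q<n. cnj (A ?j ?i $$ (q, q))) else 0)
      + (\<Sum>r<n. \<Sum>q<n. cnj (B $$ (?s, q)) * cnj (A ?j ?i $$ (r, q)) * B $$ (?p, r))"
    unfolding Phi_plus_transpose_entry[OF B A[OF yd(1) xd(1)] yd(2) xd(2)] by simp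
  also have "\<dots> = (if ?p = ?s then of_real \<alpha> * (\<Sum>q<n. A ?i ?j $$ (q, q)) else 0)
      + (\<Sum>r<n. \<Sum>q<n. cnj (B $$ (?s, q)) * A ?i ?j $$ (q, r) * B $$ (?p, r))"
    using xd yd by (auto simp: herm[of ?i ?j])
  also have "(\<Sum>r<n. \<Sum>q<n. cnj (B $$ (?s, q)) * A ?i ?j $$ (q, r) * B $$ (?p, r))
      = (\<Sum>r<n. \<Sum>q<n. B $$ (?p, q) * A ?i ?j $$ (r, q) * cnj (B $$ (?s, r)))"
    by (subst sum.swap) (simp add: mult_ac)
  also have "(if ?p = ?s then of_real \<alpha> * (\<Sum>q<n. A ?i ?j $$ (q, q)) else 0) + \<dots>
      = (Phi_plus \<alpha> B \<circ> transpose_mat) (A ?i ?j) $$ (?p, ?s)"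
    by (rule Phi_plus_transpose_entry[OF B A[OF xd(1) yd(1)] xd(2) yd(2), symmetric])
  finally show "mat_adjoint ?G $$ (x, y) = ?G $$ (x, y)"
    using x y by (simp add: block_matrix_def)
qed (simp_all add: block_matrix_def)

text \<open>One direction tests the map on rank-one block matrices; the other decomposes an
  arbitrary positive semidefinite block matrix into these and adds up.\<close>

lemma k_copositive_iff:
  assumes B: "B \<in> carrier_mat m n" and m: "0 < m"
  shows "k_copositive n m k (Phi_plus \<alpha> B)
    \<longleftrightarrow> (\<forall>a v. 0 \<le> qform m n \<alpha> (\<lambda>p q. B $$ (p, q)) (pairing k m n a v))"
proof
  assume cop: "k_copositive n m k (Phi_plus \<alpha> B)"
  show "\<forall>a v. 0 \<le> qform m n \<alpha> (\<lambda>p q. B $$ (p, q)) (pairing k m n a v)"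
  proof (intro allI)
    fix a v :: "nat \<Rightarrow> complex"
    \<comment> \<open>The blocks of \<open>a a\<^sup>*\<close>.\<close>
    define A where "A i j = mat n n (\<lambda>(r, q). a (i * n + r) * cnj (a (j * n + q)))" for i j
    have A: "A i j \<in> carrier_mat n n" for i j by (simp add: A_def)
    let ?K = "block_matrix k n A"
    have entry: "?K $$ (x, y) = a x * cnj (a y)" if "x < k * n" "y < k * n" for x y
      using that div_mod_block[of x k n] div_mod_block[of y k n] by (simp add: block_matrix_def A_def)
    have K: "?K \<in> carrier_mat (k * n) (k * n)" by (rule block_matrix_carrier)
    have "pos_semidef ?K"
      unfolding pos_semidef_def
    proof (intro conjI ballI)
      show "square_mat ?K" using K by simp
      show "mat_adjoint ?K = ?K"
        by (rule eq_matI) (use K in \<open>auto simp: entry\<close>)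
      fix w :: "complex vec" assume "w \<in> carrier_vec (dim_row ?K)"
      then have w: "w \<in> carrier_vec (k * n)" using K by simp
      \<comment> \<open>The form of \<open>a a\<^sup>*\<close> at \<open>w\<close> is the squared
        modulus of the inner product \<open>z\<close>.\<close>
      define z where "z = (\<Sum>x<k * n. a x * cnj (w $ x))"
      have "(?K *\<^sub>v w) \<bullet>c w = (\<Sum>x<k * n. \<Sum>y<k * n. (a x * cnj (w $ x)) * cnj (a y * cnj (w $ y)))"
        unfolding quadratic_form_sum[OF K w] by (intro sum.cong refl) (simp add: entry mult_ac)
      also have "\<dots> = z * cnj z" by (simp only: z_def sum_product cnj_sum)
      also have "\<dots> = of_real ((cmod z)\<^sup>2)" by (rule complex_norm_square[symmetric])
      finally show "0 \<le> (?K *\<^sub>v w) \<bullet>c w" by (simp only: less_eq_complex_def) simp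
    qed
    then have "pos_semidef (block_matrix k m (\<lambda>i j. (Phi_plus \<alpha> B \<circ> transpose_mat) (A i j)))" (is "pos_semidef ?G")
      using cop A unfolding k_copositive_def k_positive_def by blast
    moreover have G: "?G \<in> carrier_mat (k * m) (k * m)" by (rule block_matrix_carrier)
    ultimately have "0 \<le> (?G *\<^sub>v vec (k * m) v) \<bullet>c vec (k * m) v"
      by (simp add: pos_semidef_def)
    also have "\<dots> = (\<Sum>x<k * m. \<Sum>y<k * m. ?G $$ (x, y) * v y * cnj (v x))"
      by (subst quadratic_form_sum[OF G]) simp_all
    also have "\<dots> = (\<Sum>l<1::nat. qform m n \<alpha> (\<lambda>p q. B $$ (p, q)) (pairing k m n a v))"
      by (rule block_quadratic_form[OF B m A]) (simp add: A_def)
    finally show "0 \<le> qform m n \<alpha> (\<lambda>p q. B $$ (p, q)) (pairing k m n a v)" by simp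
  qed
next
  assume nonneg: "\<forall>a v. 0 \<le> qform m n \<alpha> (\<lambda>p q. B $$ (p, q)) (pairing k m n a v)"
  show "k_copositive n m k (Phi_plus \<alpha> B)"
    unfolding k_copositive_def k_positive_def
  proof (intro conjI allI impI linear_mat_map_Phi_plus_transpose[OF B])
    fix A :: "nat \<Rightarrow> nat \<Rightarrow> complex mat"
    assume A: "\<forall>i<k. \<forall>j<k. A i j \<in> carrier_mat n n" and psd: "pos_semidef (block_matrix k n A)"
    obtain a :: "nat \<Rightarrow> nat \<Rightarrow> complex" where a: "\<forall>x<k * n. \<forall>y<k * n. block_matrix k n A $$ (x, y)
        = (\<Sum>l<k * n. a l x * cnj (a l y))"
      using pos_semidef_sum_rank_one[OF block_matrix_carrier psd] by blast
    have entries: "A i j $$ (r, q) = (\<Sum>l<k * n. a l (i * n + r) * cnj (a l (j * n + q)))"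
      if "i < k" "j < k" "r < n" "q < n" for i j r q
      using a[rule_format, of "i * n + r" "j * n + q"] that
        block_index_less[of i k r n] block_index_less[of j k q n] by (simp add: block_matrix_def)
    let ?G = "block_matrix k m (\<lambda>i j. (Phi_plus \<alpha> B \<circ> transpose_mat) (A i j))"
    have G: "?G \<in> carrier_mat (k * m) (k * m)" by (rule block_matrix_carrier)
    show "pos_semidef ?G"
      unfolding pos_semidef_def
    proof (intro conjI ballI)
      show "square_mat ?G" using G by simp
      show "mat_adjoint ?G = ?G"
        by (rule block_Phi_plus_hermitian[OF B]) (use A in \<open>simp_all add: entries mult.commute\<close>)
      fix w :: "complex vec" assume "w \<in> carrier_vec (dim_row ?G)"
      then have w: "w \<in> carrier_vec (k * m)" using G by simp
      have "(?G *\<^sub>v w) \<bullet>c w = (\<Sum>l<k * n. qform m n \<alpha> (\<lambda>p q. B $$ (p, q)) (pairing k m n (a l) (\<lambda>x. w $ x)))"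
        unfolding quadratic_form_sum[OF G w]
        by (rule block_quadratic_form[OF B m]) (use A entries in auto)
      also have "\<dots> \<ge> 0" by (rule sum_nonneg) (use nonneg in blast)
      finally show "0 \<le> (?G *\<^sub>v w) \<bullet>c w" .
    qed
  qed
qed

lemma qform_cong:
  assumes "\<And>p q. p < m \<Longrightarrow> q < n \<Longrightarrow> b p q = b' p q" "\<And>p q. p < m \<Longrightarrow> q < n \<Longrightarrow> y p q = y' p q"
  shows "qform m n \<alpha> b y = qform m n \<alpha> b' y'"
  using assms by (simp add: qform_def twist_def)

text \<open>Every sum of \<open>k\<close> rank-one matrices is a pairing: the factors are stored
  block after block, and the conjugation cancels the one in \<open>pairing\<close>. Witnesses are
  fed into \<open>k_copositive_iff\<close> this way.\<close>

lemma pairing_surj: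
  assumes "p < m" "q < n"
  shows "pairing k m n (\<lambda>x. a (x div n) (x mod n)) (\<lambda>x. cnj (c (x div m) (x mod m))) p q
    = (\<Sum>i<k. a i q * c i p)"
  using assms by (simp add: pairing_def)

section \<open>Singular values and rank\<close>

text \<open>Distinct indices of \<open>f\<close> occupy distinct positions of the descending list
  \<open>ys\<close>, and for nonnegative entries the largest product over two distinct positions is
  that of the first two.\<close>

lemma top_two_of_descending_list:
  fixes f :: "nat \<Rightarrow> real"
  assumes n: "2 \<le> n" and f: "\<And>i. i < n \<Longrightarrow> f i \<ge> 0"
    and ys: "mset ys = mset (map f [0..<n])" "sorted (rev ys)"
  shows "\<exists>i j. i < n \<and> j < n \<and> i \<noteq> j \<and> f i * f j = ys ! 0 * ys ! 1"
    and "i < n \<Longrightarrow> j < n \<Longrightarrow> i \<noteq> j \<Longrightarrow> f i * f j \<le> ys ! 0 * ys ! 1"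
proof -
  have len: "length ys = n" using mset_eq_length[OF ys(1)] by simp
  \<comment> \<open>\<open>g\<close> sends an index of \<open>f\<close> to its position in
    \<open>ys\<close>, so repeated values cause no ambiguity.\<close>
  from permutation_Ex_bij[OF ys(1)[symmetric]] obtain g
    where g: "bij_betw g {..<n} {..<n}" and fg: "\<And>i. i < n \<Longrightarrow> f i = ys ! g i"
    by (auto simp: len)
  have anti: "ys ! b \<le> ys ! a" if "a \<le> b" "b < n" for a b
    using sorted_rev_nth_mono[OF ys(2)] that len by simp
  have gn: "g i < n" if "i < n" for i using g that by (auto simp: bij_betw_def)
  have onto: "\<exists>i<n. g i = b" if "b < n" for b
  proof -
    have "b \<in> g ` {..<n}" using g that by (simp add: bij_betw_imp_surj_on)
    then show ?thesis by blast
  qed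
  have nonneg: "ys ! b \<ge> 0" if "b < n" for b
    using onto[OF that] f fg by metis
  obtain i0 where i0: "i0 < n" "g i0 = 0" using onto[of 0] n by auto
  obtain j0 where j0: "j0 < n" "g j0 = 1" using onto[of 1] n by auto
  show "\<exists>i j. i < n \<and> j < n \<and> i \<noteq> j \<and> f i * f j = ys ! 0 * ys ! 1"
    using i0 j0 fg by (intro exI[of _ i0] exI[of _ j0]) auto
  have le: "ys ! a * ys ! b \<le> ys ! 0 * ys ! 1" if "a < b" "b < n" for a b
    using that n by (intro mult_mono anti nonneg) auto
  show "f i * f j \<le> ys ! 0 * ys ! 1" if "i < n" "j < n" "i \<noteq> j"
  proof -
    have "g i \<noteq> g j" using g that by (auto simp: bij_betw_def inj_on_def)
    then consider "g i < g j" | "g j < g i" by linarith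
    then show ?thesis
      using le[of "g i" "g j"] le[of "g j" "g i"] gn that fg by cases (auto simp: mult.commute)
  qed
qed

lemma proots_prod_linear:
  "proots (\<Prod>i\<leftarrow>xs. [:- complex_of_real (d i), 1:]) = mset (map (\<lambda>i. complex_of_real (d i)) xs)"
proof (induction xs)
  case (Cons x xs)
  have "(\<Prod>i\<leftarrow>xs. [:- complex_of_real (d i), 1:]) \<noteq> 0"
    by (auto simp: prod_list_zero_iff)
  then show ?case using Cons by (simp add: proots_mult del: mult_pCons_left)
qed simp

text \<open>\<open>u\<close> collects the right singular vectors, so the columns of \<open>B u\<close> are orthogonal with the
  singular values \<open>s\<close>, here unordered, as norms.\<close>

lemma singular_vectors:
  assumes B: "B \<in> carrier_mat m n" and m: "2 \<le> m" and n: "2 \<le> n"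
  obtains u :: "nat \<Rightarrow> nat \<Rightarrow> complex" and s :: "nat \<Rightarrow> real" and i j where
    "\<And>r t. r < n \<Longrightarrow> t < n \<Longrightarrow> (\<Sum>i<n. u r i * cnj (u t i)) = (if r = t then 1 else 0)"
    "\<And>i j. i < n \<Longrightarrow> j < n \<Longrightarrow> (\<Sum>r<n. u r i * cnj (u r j)) = (if i = j then 1 else 0)"
    "\<And>i j. i < n \<Longrightarrow> j < n \<Longrightarrow>
      (\<Sum>p<m. (\<Sum>q<n. B $$ (p, q) * u q i) * cnj (\<Sum>q<n. B $$ (p, q) * u q j))
        = (if i = j then of_real ((s i)\<^sup>2) else 0)"
    "\<And>i. i < n \<Longrightarrow> s i \<ge> 0"
    "\<And>i j. i < n \<Longrightarrow> j < n \<Longrightarrow> i \<noteq> j \<Longrightarrow> s i * s j \<le> \<sigma> 1 B * \<sigma> 2 B"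
    "i < n" "j < n" "i \<noteq> j" "s i * s j = \<sigma> 1 B * \<sigma> 2 B"
proof -
  define A where "A = mat_adjoint B * B"
  have A: "A \<in> carrier_mat n n" using B by (auto simp: A_def)
  have herm: "mat_adjoint A = A"
    using B by (simp add: A_def mat_adjoint_mult[of _ n m _ n])
  obtain U d where U: "U \<in> carrier_mat n n" "mat_adjoint U * U = 1\<^sub>m n" "U * mat_adjoint U = 1\<^sub>m n"
    and D: "mat_adjoint U * A * U = mat n n (\<lambda>(i, j). if i = j then complex_of_real (d i) else 0)"
    using hermitian_unitary_diagonalization[OF A herm] by blast
  define x where "x p i = (\<Sum>q<n. B $$ (p, q) * U $$ (q, i))" for p i
  have BU: "B * U \<in> carrier_mat m n" using B U(1) by auto
  have xBU: "(B * U) $$ (p, i) = x p i" if "p < m" "i < n" for p i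
    unfolding x_def by (rule mat_mult_index_sum[OF B U(1) that])
  \<comment> \<open>The diagonalized matrix is the Gram matrix of the columns of
    \<open>B * U\<close>: these are orthogonal, and \<open>d i\<close> is a squared norm.\<close>
  have gram: "mat_adjoint U * A * U = mat_adjoint (B * U) * (B * U)"
    unfolding mat_adjoint_mult[OF B U(1)] A_def
    using B U(1) BU A[unfolded A_def] by (simp add: assoc_mult_mat[of _ n n _ m _ n] assoc_mult_mat[of _ n m _ n _ n]
        assoc_mult_mat[of _ n n _ n _ n])
  have orth: "(\<Sum>p<m. x p i * cnj (x p j)) = (if i = j then of_real (d i) else 0)"
    if "i < n" "j < n" for i j
  proof -
    have "(mat_adjoint (B * U) * (B * U)) $$ (j, i)
        = (\<Sum>p<m. mat_adjoint (B * U) $$ (j, p) * (B * U) $$ (p, i))"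
      by (rule mat_mult_index_sum[OF _ BU that(2,1)]) (use BU in auto)
    also have "\<dots> = (\<Sum>p<m. x p i * cnj (x p j))"
    proof (rule sum.cong[OF refl])
      fix p assume "p \<in> {..<m}"
      then show "mat_adjoint (B * U) $$ (j, p) * (B * U) $$ (p, i) = x p i * cnj (x p j)"
        using BU that by (subst mat_adjoint_index) (simp_all add: xBU del: index_mult_mat)
    qed
    finally show ?thesis
      using D that unfolding gram by auto
  qed
  have d: "d i \<ge> 0" if "i < n" for i
  proof -
    have "complex_of_real (\<Sum>p<m. (cmod (x p i))\<^sup>2) = of_real (d i)"
      unfolding of_real_sum_cmod_square using orth[OF that that] by simp
    then have "d i = (\<Sum>p<m. (cmod (x p i))\<^sup>2)" unfolding of_real_eq_iff by simp
    then show ?thesis by (simp add: sum_nonneg)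
  qed
  define s where "s = (\<lambda>i. sqrt (d i))"
  define ys where "ys = rev (sorted_list_of_multiset (mset (map s [0..<n])))"
  have ys: "mset ys = mset (map s [0..<n])" "sorted (rev ys)"
    by (simp_all add: ys_def)
  have "image_mset (\<lambda>z. sqrt (Re z)) (proots (char_poly A)) = mset (map s [0..<n])"
    unfolding unitary_diagonal_char_poly[OF A U D] proots_prod_linear
    by (simp add: s_def image_mset.compositionality o_def)
  then have "singular_values B = take (min m n) ys"
    using B unfolding singular_values_def A_def[symmetric] ys_def by simp
  \<comment> \<open>As \<open>m\<close> and \<open>n\<close> are at least 2, the truncation in
    \<open>singular_values\<close> keeps the first two entries.\<close>
  then have \<sigma>: "\<sigma> 1 B = ys ! 0" "\<sigma> 2 B = ys ! 1"
    using m n by (simp_all add: singular_value_def)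
  have s: "s i \<ge> 0" if "i < n" for i using d[OF that] by (simp add: s_def)
  obtain i j where ij: "i < n" "j < n" "i \<noteq> j" "s i * s j = \<sigma> 1 B * \<sigma> 2 B"
    using top_two_of_descending_list(1)[OF n s ys] unfolding \<sigma> by blast
  show thesis
  proof (rule that[of "\<lambda>q i. U $$ (q, i)" s i j])
    show "(\<Sum>p<m. (\<Sum>q<n. B $$ (p, q) * U $$ (q, i)) * cnj (\<Sum>q<n. B $$ (p, q) * U $$ (q, j)))
        = (if i = j then of_real ((s i)\<^sup>2) else 0)" if "i < n" "j < n" for i j
      using orth[OF that] d[OF that(1)] unfolding x_def
      by (cases "i = j") (simp_all add: s_def flip: of_real_power)
    show "s i * s j \<le> \<sigma> 1 B * \<sigma> 2 B" if "i < n" "j < n" "i \<noteq> j" for i j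
      unfolding \<sigma> by (rule top_two_of_descending_list(2)[OF n s ys that])
  qed (use ij s unitary_entries[OF U] in auto)
qed

text \<open>A nonzero minor would make the columns \<open>q\<close> and \<open>q'\<close> distinct
  and linearly independent, forcing the rank to be at least 2.\<close>

lemma rank_le_1_minor:
  fixes B :: "complex mat"
  assumes B: "B \<in> carrier_mat m n" and rank: "vec_space.rank m B \<le> 1"
    and p: "p < m" "p' < m" and q: "q < n" "q' < n"
  shows "B $$ (p, q) * B $$ (p', q') = B $$ (p, q') * B $$ (p', q)"
proof (rule ccontr)
  assume minor: "B $$ (p, q) * B $$ (p', q') \<noteq> B $$ (p, q') * B $$ (p', q)"
  interpret vec_space "TYPE(complex)" m .
  define C where "C = mat_of_cols m [col B q, col B q']"
  have C: "C \<in> carrier_mat m 2"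
    using mat_of_cols_carrier(1)[of m "[col B q, col B q']"] by (simp add: C_def numeral_2_eq_2)
  have colsC: "cols C = [col B q, col B q']"
    unfolding C_def using B by (intro cols_mat_of_cols) (auto intro: col_carrier_vec)
  have neq: "col B q \<noteq> col B q'"
  proof
    assume "col B q = col B q'"
    then have "col B q $ r = col B q' $ r" for r by simp
    then have "B $$ (r, q) = B $$ (r, q')" if "r < m" for r using that B q by (metis carrier_matD index_col)
    then show False using minor p by simp
  qed
  have indep: "lin_indpt (set (cols C))"
  proof
    assume "lin_dep (set (cols C))"
    then obtain v where v: "v \<in> carrier_vec 2" "v \<noteq> 0\<^sub>v 2" "C *\<^sub>v v = 0\<^sub>v m"
      using lin_depE[OF C] neq colsC by auto
    have eq: "B $$ (r, q) * v $ 0 + B $$ (r, q') * v $ 1 = 0" if "r < m" for r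
    proof -
      have "(C *\<^sub>v v) $ r = B $$ (r, q) * v $ 0 + B $$ (r, q') * v $ 1"
        using C v(1) that B q
        by (simp add: scalar_prod_def C_def mat_of_cols_index numeral_2_eq_2)
      then show ?thesis using v(3) that by simp
    qed
    \<comment> \<open>Cramer's rule: the minor times either coordinate of \<open>v\<close> is a
      combination of the equations of rows \<open>p\<close> and \<open>p'\<close>.\<close>
    let ?M = "B $$ (p, q) * B $$ (p', q') - B $$ (p, q') * B $$ (p', q)"
    have "?M * v $ 0 = B $$ (p', q') * (B $$ (p, q) * v $ 0 + B $$ (p, q') * v $ 1)
        - B $$ (p, q') * (B $$ (p', q) * v $ 0 + B $$ (p', q') * v $ 1)"
      by (simp add: algebra_simps)
    moreover have "?M * v $ 1 = B $$ (p, q) * (B $$ (p', q) * v $ 0 + B $$ (p', q') * v $ 1)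
        - B $$ (p', q) * (B $$ (p, q) * v $ 0 + B $$ (p, q') * v $ 1)"
      by (simp add: algebra_simps)
    ultimately have "?M * v $ 0 = 0" "?M * v $ 1 = 0"
      unfolding eq[OF p(1)] eq[OF p(2)] by simp_all
    then have "v $ 0 = 0" "v $ 1 = 0" using minor by auto
    then have "v = 0\<^sub>v 2" using v(1) by (intro eq_vecI) (auto simp: less_2_cases_iff)
    then show False using v(2) by simp
  qed
  have "card (set (cols C)) \<le> rank B"
  proof (rule rank_ge_card_indpt[OF B _ indep])
    show "set (cols C) \<subseteq> set (cols B)"
      unfolding colsC using B q by (auto simp: cols_def)
  qed
  then show False using rank neq by (simp add: colsC)
qed

text \<open>The equality case of Cauchy-Schwarz: vanishing minors make the product of the squared
  norms equal to the squared modulus of the inner product, which is 0.\<close>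

lemma orthogonal_columns_vanishing_minors:
  fixes x :: "nat \<Rightarrow> nat \<Rightarrow> complex" and s :: "nat \<Rightarrow> real"
  assumes minor: "\<And>p p'. p < m \<Longrightarrow> p' < m \<Longrightarrow> x p i * x p' j = x p j * x p' i"
    and norms: "(\<Sum>p<m. x p i * cnj (x p i)) = of_real ((s i)\<^sup>2)" "(\<Sum>p<m. x p j * cnj (x p j)) = of_real ((s j)\<^sup>2)"
    and orth: "(\<Sum>p<m. x p i * cnj (x p j)) = 0"
  shows "s i * s j = 0"
proof -
  have "of_real ((s i)\<^sup>2) * of_real ((s j)\<^sup>2)
      = (\<Sum>p<m. \<Sum>p'<m. (x p i * x p' j) * (cnj (x p i) * cnj (x p' j)))"
    unfolding norms[symmetric] sum_product by (simp add: mult_ac)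
  also have "\<dots> = (\<Sum>p<m. \<Sum>p'<m. (x p j * x p' i) * (cnj (x p i) * cnj (x p' j)))"
    by (intro sum.cong refl arg_cong2[where f = "(*)"] minor) auto
  also have "\<dots> = (\<Sum>p<m. x p j * cnj (x p i)) * (\<Sum>p<m. x p i * cnj (x p j))"
    unfolding sum_product by (simp add: mult_ac)
  also have "\<dots> = 0" by (simp add: orth)
  finally have "complex_of_real ((s i)\<^sup>2 * (s j)\<^sup>2) = 0" by simp
  then show ?thesis unfolding of_real_eq_0_iff by simp
qed

section \<open>Necessary and sufficient conditions\<close>

text \<open>Since \<open>n\<close> is at least 2, some nonzero \<open>w\<close> is orthogonal to the
  first row of \<open>B\<close>. On the rank-one matrix with first row \<open>w\<close> and zeros
  elsewhere the square in \<open>qform_rank_one\<close> vanishes, leaving \<alpha> times the squared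
  norm of \<open>w\<close>.\<close>

lemma k_copositive_nonneg:
  assumes B: "B \<in> carrier_mat m n" and m: "1 \<le> m" and n: "2 \<le> n" and k: "1 \<le> k"
    and cop: "k_copositive n m k (Phi_plus \<alpha> B)"
  shows "0 \<le> \<alpha>"
proof -
  define b where "b q = B $$ (0, q)" for q
  \<comment> \<open>Two coordinates suffice for orthogonality to \<open>b\<close>; the first
    alternative keeps \<open>w\<close> nonzero when both entries of \<open>b\<close> vanish.\<close>
  define w :: "nat \<Rightarrow> complex" where
    "w = (if b 0 = 0 \<and> b 1 = 0 then (\<lambda>q. if q = 0 then 1 else 0)
      else (\<lambda>q. if q = 0 then cnj (b 1) else if q = 1 then - cnj (b 0) else 0))"
  define c :: "nat \<Rightarrow> complex" where "c p = (if p = 0 then 1 else 0)" for p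
  \<comment> \<open>Only block 0 is used; the zero blocks of \<open>a'\<close> silence the copies of
    \<open>c\<close> in the others.\<close>
  define a' where "a' i q = (if i = 0 then w q else 0)" for i q :: nat
  define c' where "c' i p = c p" for i p :: nat
  have "0 \<le> qform m n \<alpha> (\<lambda>p q. B $$ (p, q))
      (pairing k m n (\<lambda>x. a' (x div n) (x mod n)) (\<lambda>x. cnj (c' (x div m) (x mod m))))"
    using cop k_copositive_iff[OF B] m by simp
  also have "\<dots> = qform m n \<alpha> (\<lambda>p q. B $$ (p, q)) (\<lambda>p q. w q * c p)"
  proof (rule qform_cong[OF refl])
    fix p q assume "p < m" "q < n"
    then have "pairing k m n (\<lambda>x. a' (x div n) (x mod n)) (\<lambda>x. cnj (c' (x div m) (x mod m))) p q
      = (\<Sum>i<k. a' i q * c' i p)" by (rule pairing_surj)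
    also have "\<dots> = (\<Sum>i<k. if i = 0 then w q * c p else 0)"
      by (rule sum.cong) (auto simp: a'_def c'_def)
    finally show "pairing k m n (\<lambda>x. a' (x div n) (x mod n)) (\<lambda>x. cnj (c' (x div m) (x mod m))) p q
      = w q * c p" using k by simp
  qed
  also have "\<dots> = of_real (\<alpha> * ((\<Sum>p<m. (cmod (c p))\<^sup>2) * (\<Sum>q<n. (cmod (w q))\<^sup>2))
       + (cmod (\<Sum>r<n. w r * cnj (\<Sum>p<m. B $$ (p, r) * c p)))\<^sup>2)"
    by (rule qform_rank_one)
  also have "(\<Sum>p<m. (cmod (c p))\<^sup>2) = 1"
  proof -
    have "(\<Sum>p<m. (cmod (c p))\<^sup>2) = (\<Sum>p<m. if p = 0 then 1 else 0)"
      by (rule sum.cong) (auto simp: c_def)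
    then show ?thesis using m by simp
  qed
  also have "(\<Sum>r<n. w r * cnj (\<Sum>p<m. B $$ (p, r) * c p)) = 0"
  proof -
    have "(\<Sum>p<m. B $$ (p, r) * c p) = b r" for r
    proof -
      have "(\<Sum>p<m. B $$ (p, r) * c p) = (\<Sum>p<m. if p = 0 then B $$ (p, r) else 0)"
        by (rule sum.cong) (auto simp: c_def)
      then show ?thesis using m by (simp add: b_def)
    qed
    then have "(\<Sum>r<n. w r * cnj (\<Sum>p<m. B $$ (p, r) * c p)) = (\<Sum>r<n. w r * cnj (b r))" by simp
    also have "\<dots> = (\<Sum>r\<in>{0, 1}. w r * cnj (b r))"
      by (rule sum.mono_neutral_right) (use n in \<open>auto simp: w_def\<close>)
    also have "\<dots> = 0" by (simp add: w_def)
    finally show ?thesis .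
  qed
  finally have "0 \<le> complex_of_real (\<alpha> * (\<Sum>q<n. (cmod (w q))\<^sup>2))" by simp
  then have "0 \<le> \<alpha> * (\<Sum>q<n. (cmod (w q))\<^sup>2)"
    by (simp only: less_eq_complex_def Re_complex_of_real zero_complex.simps)
  moreover have "0 < (\<Sum>q<n. (cmod (w q))\<^sup>2)"
  proof -
    have "w 0 \<noteq> 0 \<or> w 1 \<noteq> 0" by (auto simp: w_def)
    then obtain q where "q < n" "w q \<noteq> 0" using n by (metis less_le_trans one_less_numeral_iff pos2 semiring_norm(76))
    then show ?thesis by (intro sum_pos2[of _ q]) auto
  qed
  ultimately show ?thesis by (simp add: zero_le_mult_iff)
qed

text \<open>The matrix of \<open>qform_antisymmetric\<close>, carried back to the original basis, is
  a sum of two rank-one matrices and therefore a pairing as soon as \<open>k\<close> is at least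
  2.\<close>

lemma k_copositive_singular_bound:
  fixes u :: "nat \<Rightarrow> nat \<Rightarrow> complex" and s :: "nat \<Rightarrow> real"
  assumes B: "B \<in> carrier_mat m n" and m: "1 \<le> m" and k: "2 \<le> k"
    and u: "\<And>r t. r < n \<Longrightarrow> t < n \<Longrightarrow> (\<Sum>i<n. u r i * cnj (u t i)) = (if r = t then 1 else 0)"
      "\<And>i j. i < n \<Longrightarrow> j < n \<Longrightarrow> (\<Sum>r<n. u r i * cnj (u r j)) = (if i = j then 1 else 0)"
    and orth: "\<And>i j. i < n \<Longrightarrow> j < n \<Longrightarrow>
      (\<Sum>p<m. (\<Sum>q<n. B $$ (p, q) * u q i) * cnj (\<Sum>q<n. B $$ (p, q) * u q j))
        = (if i = j then of_real ((s i)\<^sup>2) else 0)"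
    and ij: "i < n" "j < n" "i \<noteq> j" and pos: "s i > 0" "s j > 0"
    and cop: "k_copositive n m k (Phi_plus \<alpha> B)"
  shows "s i * s j \<le> \<alpha>"
proof -
  define x where "x p l = (\<Sum>q<n. B $$ (p, q) * u q l)" for p l
  define c1 where "c1 p = cnj (x p j) / of_real (s j)" for p
  define c2 where "c2 p = - cnj (x p i) / of_real (s i)" for p
  define y where "y p l = (if l = i then 1 else 0) * c1 p + (if l = j then 1 else 0) * c2 p" for p l
  \<comment> \<open>This is \<open>y\<close> times the adjoint of \<open>u\<close>, chosen so that
    multiplication by \<open>u\<close> gives back \<open>y\<close>.\<close>
  define Y where "Y p q = cnj (u q i) * c1 p + cnj (u q j) * c2 p" for p q
  have Yu: "(\<Sum>q<n. Y p q * u q l) = y p l" if "l < n" for p l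
  proof -
    have "(\<Sum>q<n. Y p q * u q l) = (\<Sum>q<n. u q l * cnj (u q i)) * c1 p + (\<Sum>q<n. u q l * cnj (u q j)) * c2 p"
      by (simp add: Y_def sum.distrib sum_distrib_left algebra_simps)
    then show ?thesis using u(2)[OF that ij(1)] u(2)[OF that ij(2)] by (simp add: y_def)
  qed
  define a where "a t q = (if t = 0 then cnj (u q i) else if t = 1 then cnj (u q j) else 0)" for t q :: nat
  define c where "c t p = (if t = 0 then c1 p else c2 p)" for t p :: nat
  have pair: "pairing k m n (\<lambda>x. a (x div n) (x mod n)) (\<lambda>x. cnj (c (x div m) (x mod m))) p q = Y p q"
    if "p < m" "q < n" for p q
  proof -
    have "(\<Sum>t<k. a t q * c t p) = (\<Sum>t\<in>{0, 1}. a t q * c t p)"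
      by (rule sum.mono_neutral_right) (use k in \<open>auto simp: a_def\<close>)
    also have "\<dots> = Y p q" by (simp add: a_def c_def Y_def)
    finally show ?thesis unfolding pairing_surj[OF that] .
  qed
  have "0 \<le> qform m n \<alpha> (\<lambda>p q. B $$ (p, q))
      (pairing k m n (\<lambda>x. a (x div n) (x mod n)) (\<lambda>x. cnj (c (x div m) (x mod m))))"
    using cop k_copositive_iff[OF B] m by simp
  also have "\<dots> = qform m n \<alpha> (\<lambda>p q. B $$ (p, q)) Y"
    by (rule qform_cong) (simp_all add: pair)
  also have "\<dots> = qform m n \<alpha> x (\<lambda>p l. \<Sum>q<n. Y p q * u q l)"
    unfolding x_def by (rule qform_unitary[OF u(1), symmetric])
  also have "\<dots> = qform m n \<alpha> x y"
    by (rule qform_cong) (simp_all add: Yu)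
  also have "\<dots> = of_real (2 * \<alpha> - 2 * (s i * s j))"
    unfolding y_def c1_def c2_def by (rule qform_antisymmetric[OF _ pos ij]) (use orth x_def in simp)
  finally show ?thesis
    by (simp only: less_eq_complex_def Re_complex_of_real zero_complex.simps) simp
qed

text \<open>In the basis of right singular vectors the form is nonnegative on every
  \<open>Y\<close>, whatever its rank, which settles all \<open>k\<close> at once.\<close>

lemma k_copositive_sufficient:
  fixes u :: "nat \<Rightarrow> nat \<Rightarrow> complex" and s :: "nat \<Rightarrow> real"
  assumes B: "B \<in> carrier_mat m n" and m: "1 \<le> m"
    and u: "\<And>r t. r < n \<Longrightarrow> t < n \<Longrightarrow> (\<Sum>i<n. u r i * cnj (u t i)) = (if r = t then 1 else 0)"
    and orth: "\<And>i j. i < n \<Longrightarrow> j < n \<Longrightarrow>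
      (\<Sum>p<m. (\<Sum>q<n. B $$ (p, q) * u q i) * cnj (\<Sum>q<n. B $$ (p, q) * u q j))
        = (if i = j then of_real ((s i)\<^sup>2) else 0)"
    and s: "\<And>i. i < n \<Longrightarrow> s i \<ge> 0"
    and \<alpha>: "0 \<le> \<alpha>" "\<And>i j. i < n \<Longrightarrow> j < n \<Longrightarrow> i \<noteq> j \<Longrightarrow> s i * s j \<le> \<alpha>"
  shows "k_copositive n m k (Phi_plus \<alpha> B)"
proof -
  have "0 \<le> qform m n \<alpha> (\<lambda>p q. B $$ (p, q)) y" for y
  proof -
    have "0 \<le> qform m n \<alpha> (\<lambda>p i. \<Sum>q<n. B $$ (p, q) * u q i) (\<lambda>p i. \<Sum>q<n. y p q * u q i)"
      using orth s \<alpha> by (rule qform_nonneg_orthogonal_columns)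
    then show ?thesis
      using qform_unitary[OF u, of m \<alpha> "\<lambda>p q. B $$ (p, q)" y] by (simp only:)
  qed
  then show ?thesis using k_copositive_iff[OF B] m by simp
qed

text \<open>With a single block the pairing has rank one, where the form is \<alpha> times a product
  of squared norms plus a square.\<close>

lemma one_copositive_sufficient:
  assumes B: "B \<in> carrier_mat m n" and m: "1 \<le> m" and \<alpha>: "0 \<le> \<alpha>"
  shows "k_copositive n m 1 (Phi_plus \<alpha> B)"
proof -
  have "0 \<le> qform m n \<alpha> (\<lambda>p q. B $$ (p, q)) (pairing 1 m n a v)" for a v
  proof -
    have "pairing 1 m n a v = (\<lambda>p q. a q * cnj (v p))" by (intro ext) (simp add: pairing_def)
    moreover have "0 \<le> complex_of_real r" if "0 \<le> r" for r
      using that by (simp add: less_eq_complex_def)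
    ultimately show ?thesis
      using \<alpha> unfolding qform_rank_one by (simp only: qform_rank_one) (simp add: sum_nonneg del: of_real_add of_real_mult)
  qed
  then show ?thesis using k_copositive_iff[OF B] m by simp
qed

theorem corollary4p9:
  fixes m n k :: nat and \<alpha> :: real and B :: "complex mat"
  assumes "2 \<le> m" and "2 \<le> n" and "1 \<le> k" and "k \<le> m"
    and "B \<in> carrier_mat m n"
  shows "if k = 1 \<or> vec_space.rank m B \<le> 1
         then k_copositive n m k (Phi_plus \<alpha> B) \<longleftrightarrow> \<alpha> \<ge> 0
         else k_copositive n m k (Phi_plus \<alpha> B) \<longleftrightarrow> \<alpha> \<ge> \<sigma> 1 B * \<sigma> 2 B"
proof -
  note B = assms(5)
  have m: "1 \<le> m" using assms(1) by simp
  obtain u :: "nat \<Rightarrow> nat \<Rightarrow> complex" and s :: "nat \<Rightarrow> real" and i j where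
    u: "\<And>r t. r < n \<Longrightarrow> t < n \<Longrightarrow> (\<Sum>i<n. u r i * cnj (u t i)) = (if r = t then 1 else 0)"
      "\<And>i j. i < n \<Longrightarrow> j < n \<Longrightarrow> (\<Sum>r<n. u r i * cnj (u r j)) = (if i = j then 1 else 0)"
    and orth: "\<And>i j. i < n \<Longrightarrow> j < n \<Longrightarrow>
      (\<Sum>p<m. (\<Sum>q<n. B $$ (p, q) * u q i) * cnj (\<Sum>q<n. B $$ (p, q) * u q j))
        = (if i = j then of_real ((s i)\<^sup>2) else 0)"
    and s: "\<And>i. i < n \<Longrightarrow> s i \<ge> 0"
    and le: "\<And>i j. i < n \<Longrightarrow> j < n \<Longrightarrow> i \<noteq> j \<Longrightarrow> s i * s j \<le> \<sigma> 1 B * \<sigma> 2 B"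
    and ij: "i < n" "j < n" "i \<noteq> j" and eq: "s i * s j = \<sigma> 1 B * \<sigma> 2 B"
    by (rule singular_vectors[OF B assms(1,2)]) blast
  have nonneg: "0 \<le> \<sigma> 1 B * \<sigma> 2 B"
    unfolding eq[symmetric] using s ij by (intro mult_nonneg_nonneg) auto
  have necessary: "0 \<le> \<alpha>" if "k_copositive n m k (Phi_plus \<alpha> B)"
    by (rule k_copositive_nonneg[OF B m assms(2,3) that])
  have sufficient: "k_copositive n m k (Phi_plus \<alpha> B)" if "\<sigma> 1 B * \<sigma> 2 B \<le> \<alpha>"
  proof (rule k_copositive_sufficient[OF B m u(1) orth s])
    show "0 \<le> \<alpha>" using nonneg that by simp
    show "s i * s j \<le> \<alpha>" if "i < n" "j < n" "i \<noteq> j" for i j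
      using le[OF that] \<open>\<sigma> 1 B * \<sigma> 2 B \<le> \<alpha>\<close> by simp
  qed
  consider (one) "k = 1" | (rank) "k \<noteq> 1" "vec_space.rank m B \<le> 1"
    | (general) "2 \<le> k" "\<not> vec_space.rank m B \<le> 1" using assms(3) by linarith
  then show ?thesis
  proof cases
    case one
    then show ?thesis using necessary one_copositive_sufficient[OF B m] by auto
  next
    \<comment> \<open>The minors of \<open>B\<close> vanish, hence so do those of columns
      \<open>i\<close> and \<open>j\<close> of \<open>B u\<close>. Thus \<sigma> 1 B * \<sigma> 2 B
      is 0 and the two bounds coincide.\<close>
    case rank
    define x where "x p l = (\<Sum>q<n. B $$ (p, q) * u q l)" for p l
    have "s i * s j = 0"
    proof (rule orthogonal_columns_vanishing_minors[of m x])
      fix p p' assume p: "p < m" "p' < m"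
      have "x p i * x p' j = (\<Sum>q<n. \<Sum>q'<n. (B $$ (p, q) * B $$ (p', q')) * (u q i * u q' j))"
        by (simp add: x_def sum_product mult_ac)
      also have "\<dots> = (\<Sum>q<n. \<Sum>q'<n. (B $$ (p, q') * B $$ (p', q)) * (u q i * u q' j))"
        by (intro sum.cong refl arg_cong2[where f = "(*)"] rank_le_1_minor[OF B rank(2) p]) auto
      also have "\<dots> = (\<Sum>q'<n. \<Sum>q<n. (B $$ (p, q') * B $$ (p', q)) * (u q i * u q' j))"
        by (rule sum.swap)
      also have "\<dots> = x p j * x p' i"
        unfolding x_def sum_product by (intro sum.cong refl) (simp add: mult_ac)
      finally show "x p i * x p' j = x p j * x p' i" .
    qed (use orth ij in \<open>simp_all add: x_def\<close>)
    then show ?thesis using rank necessary sufficient eq by auto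
  next
    case general
    have "\<sigma> 1 B * \<sigma> 2 B \<le> \<alpha>" if cop: "k_copositive n m k (Phi_plus \<alpha> B)"
    \<comment> \<open>A vanishing column cannot be normalized for the antisymmetric witness, but
      then the claimed bound is just \<alpha> \<ge> 0.\<close>
    proof (cases "s i = 0 \<or> s j = 0")
      case True
      then show ?thesis using eq necessary[OF cop] by auto
    next
      case False
      then have "s i > 0" "s j > 0" using s[OF ij(1)] s[OF ij(2)] by auto
      from k_copositive_singular_bound[OF B m general(1) u orth ij this cop]
      show ?thesis using eq by simp
    qed
    then show ?thesis using general sufficient by auto
  qed
qed

end
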